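(* There exists an absolute constant $C>0$ such that the following holds for every sufficiently large $n$ and every integer $N$ with \[ C n^2 \le N \le \exp\!\left(\frac{n}{C}\right). \] There exists a convex body $K \subseteq \mathbb{R}^n$ such that for every vector $\xi'\in\mathbb{R}^n$ lying on the line segment connecting the barycenter of $K$ and the Santaló point of $K$, every polytope $P\subseteq\mathbb{R}^n$ satisfying \[ P \subseteq K-\xi' \subseteq \frac{n}{C\log N}\,P \] has at least $N$ facets.
   Context: A convex body is a compact convex set with nonempty interior. The barycenter of $K$ is its centroid $\frac{1}{|K|}\int_K x\,dx$. For a convex body $L$ containing the origin in its interior, its polar is $L^\circ=\{y:\langle y,z\rangle\le 1 \text{ for all } z\in L\}$. The Santaló point of a convex body $K$ is the unique point $x$ in the interior of $K$ at which $|K-x|\cdot|(K-x)^\circ|$ attains its minimum, where $|\cdot|$ denotes volume. *)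

theory Defs
  imports "HOL-Analysis.Analysis"
begin

text \<open>R^n is modelled as the functions nat => real vanishing from index n on
  (coordinates 0..n-1). The topology on nat => real is the product topology,
  which on Rn n coincides with the Euclidean one.\<close>

type_synonym vec = "nat \<Rightarrow> real"

definition Rn :: "nat \<Rightarrow> vec set" where
  "Rn n = {x. \<forall>i\<ge>n. x i = 0}"

definition vadd :: "vec \<Rightarrow> vec \<Rightarrow> vec" where "vadd x y = (\<lambda>i. x i + y i)"
definition vsub :: "vec \<Rightarrow> vec \<Rightarrow> vec" where "vsub x y = (\<lambda>i. x i - y i)"
definition vscale :: "real \<Rightarrow> vec \<Rightarrow> vec" where "vscale t x = (\<lambda>i. t * x i)"

definition ip :: "nat \<Rightarrow> vec \<Rightarrow> vec \<Rightarrow> real" where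
  "ip n x y = (\<Sum>i<n. x i * y i)"

definition dist_n :: "nat \<Rightarrow> vec \<Rightarrow> vec \<Rightarrow> real" where
  "dist_n n x y = sqrt (\<Sum>i<n. (x i - y i)^2)"

definition interior_n :: "nat \<Rightarrow> vec set \<Rightarrow> vec set" where
  "interior_n n K = {x \<in> K. \<exists>e>0. \<forall>y\<in>Rn n. dist_n n x y < e \<longrightarrow> y \<in> K}"

definition convex_n :: "vec set \<Rightarrow> bool" where
  "convex_n K = (\<forall>x\<in>K. \<forall>y\<in>K. \<forall>u::real. 0 \<le> u \<and> u \<le> 1 \<longrightarrow> vadd (vscale u x) (vscale (1 - u) y) \<in> K)"

definition convex_body :: "nat \<Rightarrow> vec set \<Rightarrow> bool" where
  "convex_body n K = (K \<subseteq> Rn n \<and> compact K \<and> convex_n K \<and> interior_n n K \<noteq> {})"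

definition leb :: "nat \<Rightarrow> vec measure" where
  "leb n = Pi\<^sub>M {..<n} (\<lambda>_. lborel)"

definition vol :: "nat \<Rightarrow> vec set \<Rightarrow> real" where
  "vol n A = measure (leb n) ((\<lambda>x. restrict x {..<n}) ` A)"

definition barycenter :: "nat \<Rightarrow> vec set \<Rightarrow> vec" where
  "barycenter n K = (\<lambda>i. if i < n then
      (\<integral>x. indicator ((\<lambda>x. restrict x {..<n}) ` K) x * x i \<partial>leb n) / vol n K else 0)"

definition polar :: "nat \<Rightarrow> vec set \<Rightarrow> vec set" where
  "polar n L = {y \<in> Rn n. \<forall>z\<in>L. ip n y z \<le> 1}"

definition translate :: "vec set \<Rightarrow> vec \<Rightarrow> vec set" where
  "translate K p = (\<lambda>x. vsub x p) ` K"

definition dilate :: "real \<Rightarrow> vec set \<Rightarrow> vec set" where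
  "dilate t P = vscale t ` P"

definition santalo_point :: "nat \<Rightarrow> vec set \<Rightarrow> vec \<Rightarrow> bool" where
  "santalo_point n K s = (s \<in> interior_n n K \<and>
     (\<forall>y\<in>interior_n n K. vol n (translate K s) * vol n (polar n (translate K s))
                         \<le> vol n (translate K y) * vol n (polar n (translate K y))))"

definition seg :: "vec \<Rightarrow> vec \<Rightarrow> vec set" where
  "seg a b = {vadd (vscale (1 - u) a) (vscale u b) | u::real. 0 \<le> u \<and> u \<le> 1}"

definition polytope_n :: "nat \<Rightarrow> vec set \<Rightarrow> bool" where
  "polytope_n n P = (\<exists>S. finite S \<and> S \<subseteq> Rn n \<and>
     P = {x. \<exists>w. (\<forall>s\<in>S. 0 \<le> w s) \<and> sum w S = 1 \<and> x = (\<lambda>i. \<Sum>s\<in>S. w s * s i)})"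

text \<open>Facet: a face cut out by a supporting hyperplane, of affine dimension n-1
  (contains n affinely independent points p 0, ..., p (n-1)).\<close>
definition facet_n :: "nat \<Rightarrow> vec set \<Rightarrow> vec set \<Rightarrow> bool" where
  "facet_n n P F = (\<exists>a b. a \<in> Rn n \<and> (\<exists>i<n. a i \<noteq> 0) \<and> (\<forall>x\<in>P. ip n a x \<le> b) \<and>
     F = {x \<in> P. ip n a x = b} \<and>
     (\<exists>p :: nat \<Rightarrow> vec. (\<forall>i<n. p i \<in> F) \<and>
        (\<forall>c :: nat \<Rightarrow> real. (\<forall>j<n. (\<Sum>i\<in>{1..<n}. c i * (p i j - p 0 j)) = 0)
            \<longrightarrow> (\<forall>i\<in>{1..<n}. c i = 0))))"

end

theory Submission
  imports Defs
begin

text \<open>The body \<open>K\<close> is the part below \<open>\<Sum>i<k. x i = 1\<close> of a product of \<open>k\<close> Lorentz cones of dimension about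
  \<open>64 ln N\<close>, that is,
  the join of 0 and \<open>k\<close> Euclidean balls, with \<open>k\<close> of order \<open>n / ln N\<close>. A point \<open>\<xi>\<close> of \<open>K\<close> with positive
  heights in all cones has height at most \<open>1 / k\<close> in one of them. Pulling \<open>\<xi>\<close> slightly towards 0 and replacing
  its component in that cone by a random vector just outside the cone gives a point outside \<open>K\<close>. By Hoeffding's
  inequality, a half-space \<open>H\<close> with \<open>K - \<xi> \<subseteq> t H\<close> and \<open>t\<close> below a small multiple of \<open>k\<close> misses this point, shifted
  by \<open>- \<xi>\<close>, with probability at most \<open>1 / N\<close>. So if \<open>P\<close> had fewer than \<open>N\<close> facets, one of these points would lie
  in \<open>P + \<xi> \<subseteq> K\<close>.\<close>

section \<open>Linear algebra and convex hulls in coordinates\<close>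

text \<open>Gaussian elimination, by induction on the equations: an equation with a nonzero
  coefficient at \<open>j0\<close> expresses that unknown through the others. Vanishing off
  \<open>J\<close> puts the solution into \<open>Rn n\<close> when \<open>J\<close> is
  \<open>{..<n}\<close>.\<close>

lemma underdetermined_system:
  fixes v :: "'i \<Rightarrow> 'j \<Rightarrow> real"
  assumes "finite I" "finite J" "card I < card J"
  shows "\<exists>d. (\<exists>j\<in>J. d j \<noteq> 0) \<and> (\<forall>j. j \<notin> J \<longrightarrow> d j = 0) \<and> (\<forall>i\<in>I. (\<Sum>j\<in>J. v i j * d j) = 0)"
  using assms
proof (induction I arbitrary: J v rule: finite_induct)
  case empty
  then obtain j where "j \<in> J" by (metis card_gt_0_iff card.empty ex_in_conv)
  then show ?case by (intro exI[of _ "\<lambda>l. if l = j then 1 else 0"]) auto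
next
  case (insert i0 I)
  show ?case
  proof (cases "\<forall>j\<in>J. v i0 j = 0")
    case True
    have "card I < card J" using insert by simp
    with insert.IH[of J v] insert.prems obtain d where
      "\<exists>j\<in>J. d j \<noteq> 0" "\<forall>j. j \<notin> J \<longrightarrow> d j = 0" "\<forall>i\<in>I. (\<Sum>j\<in>J. v i j * d j) = 0" by blast
    then show ?thesis using True by (intro exI[of _ d]) auto
  next
    case False
    then obtain j0 where j0: "j0 \<in> J" "v i0 j0 \<noteq> 0" by auto
    define J' where "J' = J - {j0}"
    have J': "finite J'" "card I < card J'" "J = insert j0 J'" "j0 \<notin> J'"
      using insert j0 by (auto simp: J'_def)
    \<comment> \<open>The remaining equations after substituting for the unknown
      \<open>j0\<close>.\<close>
    define v' where "v' = (\<lambda>i j. v i j - v i j0 * v i0 j / v i0 j0)"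
    from insert.IH[OF J'(1,2), of v'] obtain d where d:
      "\<exists>j\<in>J'. d j \<noteq> 0" "\<forall>j. j \<notin> J' \<longrightarrow> d j = 0" "\<forall>i\<in>I. (\<Sum>j\<in>J'. v' i j * d j) = 0" by blast
    define e where "e = d(j0 := - (\<Sum>j\<in>J'. v i0 j * d j) / v i0 j0)"
    have e: "(\<Sum>j\<in>J. v i j * e j) = v i j0 * e j0 + (\<Sum>j\<in>J'. v i j * d j)" for i
    proof -
      have "(\<Sum>j\<in>J'. v i j * e j) = (\<Sum>j\<in>J'. v i j * d j)"
        using J' by (intro sum.cong) (auto simp: e_def)
      then show ?thesis using J' by simp
    qed
    have "(\<Sum>j\<in>J. v i0 j * e j) = 0" unfolding e using j0 by (simp add: e_def)
    moreover have "(\<Sum>j\<in>J. v i j * e j) = 0" if "i \<in> I" for i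
    proof -
      have "0 = (\<Sum>j\<in>J'. v i j * d j - v i j0 / v i0 j0 * (v i0 j * d j))"
        using d(3) that by (simp add: v'_def left_diff_distrib mult.assoc)
      also have "\<dots> = (\<Sum>j\<in>J'. v i j * d j) - v i j0 / v i0 j0 * (\<Sum>j\<in>J'. v i0 j * d j)"
        by (simp add: sum_subtractf sum_distrib_left)
      finally show ?thesis unfolding e by (simp add: e_def)
    qed
    moreover have "\<exists>j\<in>J. e j \<noteq> 0" using d(1) J' by (auto simp: e_def)
    moreover have "\<forall>j. j \<notin> J \<longrightarrow> e j = 0" using d(2) J' by (auto simp: e_def)
    ultimately show ?thesis by blast
  qed
qed

section \<open>Bilinearity of the inner product\<close>

lemma ip_add_left: "ip n (\<lambda>i. x i + y i) z = ip n x z + ip n y z"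
  by (simp add: ip_def algebra_simps sum.distrib)
lemma ip_add_right: "ip n z (\<lambda>i. x i + y i) = ip n z x + ip n z y"
  by (simp add: ip_def algebra_simps sum.distrib)
lemma ip_diff_left: "ip n (\<lambda>i. x i - y i) z = ip n x z - ip n y z"
  by (simp add: ip_def algebra_simps sum_subtractf)
lemma ip_diff_right: "ip n z (\<lambda>i. x i - y i) = ip n z x - ip n z y"
  by (simp add: ip_def algebra_simps sum_subtractf)
lemma ip_scale_left: "ip n (\<lambda>i. t * x i) z = t * ip n x z"
  by (simp add: ip_def algebra_simps sum_distrib_left)
lemma ip_scale_right: "ip n z (\<lambda>i. t * x i) = t * ip n z x"
  by (simp add: ip_def algebra_simps sum_distrib_left)
lemma ip_sum_right: "ip n z (\<lambda>i. \<Sum>s\<in>S. w s * f s i) = (\<Sum>s\<in>S. w s * ip n z (f s))"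
  by (simp add: ip_def sum_distrib_left algebra_simps) (rule sum.swap)

lemmas ip_simps = ip_add_left ip_add_right ip_diff_left ip_diff_right ip_scale_left ip_scale_right

lemma ip_unit: "i < n \<Longrightarrow> ip n d (\<lambda>j. if j = i then r else 0) = d i * r"
  by (simp add: ip_def if_distrib[of "\<lambda>x. _ * x"] cong: if_cong)

text \<open>A greedy choice: fewer than \<open>n\<close> vectors have a common nonzero orthogonal
  vector \<open>d\<close>, and by hypothesis some member of \<open>A\<close> is not orthogonal to
  \<open>d\<close>; it extends the list.\<close>

lemma spanning_imp_independent:
  assumes span: "\<And>d. d \<in> Rn n \<Longrightarrow> (\<forall>s\<in>A. ip n d s = 0) \<Longrightarrow> d = (\<lambda>_. 0)"
  shows "\<exists>p :: nat \<Rightarrow> vec. (\<forall>i<n. p i \<in> A) \<and>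
    (\<forall>c. (\<forall>j<n. (\<Sum>i<n. c i * p i j) = 0) \<longrightarrow> (\<forall>i<n. c i = 0))"
proof -
  have "r \<le> n \<Longrightarrow> \<exists>p :: nat \<Rightarrow> vec. (\<forall>i<r. p i \<in> A) \<and>
    (\<forall>c. (\<forall>j<n. (\<Sum>i<r. c i * p i j) = 0) \<longrightarrow> (\<forall>i<r. c i = 0))" for r
  proof (induction r)
    case 0 then show ?case by simp
  next
    case (Suc r)
    then obtain p where p: "\<forall>i<r. p i \<in> A"
      "\<And>c. (\<forall>j<n. (\<Sum>i<r. c i * p i j) = 0) \<Longrightarrow> (\<forall>i<r. c i = 0)" by auto
    from underdetermined_system[of "{..<r}" "{..<n}" p] Suc.prems obtain d where d:
      "\<exists>j<n. d j \<noteq> 0" "\<forall>j. \<not> j < n \<longrightarrow> d j = 0" "\<forall>i<r. ip n (p i) d = 0"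
      by (auto simp: ip_def)
    have "d \<in> Rn n" "d \<noteq> (\<lambda>_. 0)" using d by (auto simp: Rn_def)
    with span obtain s where s: "s \<in> A" "ip n d s \<noteq> 0" by blast
    define q where "q = p(r := s)"
    have "\<forall>i<Suc r. c i = 0" if c: "\<forall>j<n. (\<Sum>i<Suc r. c i * q i j) = 0" for c
    proof -
      have c': "(\<Sum>i<r. c i * p i j) + c r * s j = 0" if "j < n" for j
      proof -
        have "(\<Sum>i<r. c i * q i j) = (\<Sum>i<r. c i * p i j)"
          by (intro sum.cong) (auto simp: q_def)
        with c that show ?thesis by (simp add: q_def)
      qed
      \<comment> \<open>Pairing the relation with \<open>d\<close> removes all old vectors and
        isolates the coefficient of the new one.\<close>
      have "0 = (\<Sum>j<n. d j * ((\<Sum>i<r. c i * p i j) + c r * s j))" using c' by simp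
      also have "\<dots> = ip n d (\<lambda>j. (\<Sum>i<r. c i * p i j)) + c r * ip n d s"
        by (simp add: ip_def algebra_simps sum.distrib sum_distrib_left)
      also have "ip n d (\<lambda>j. (\<Sum>i<r. c i * p i j)) = (\<Sum>i<r. c i * ip n d (p i))"
        by (rule ip_sum_right)
      also have "\<dots> = 0" using d(3) by (intro sum.neutral) (auto simp: ip_def mult.commute)
      finally have "c r = 0" using s by simp
      with c' have "\<forall>j<n. (\<Sum>i<r. c i * p i j) = 0" by simp
      with p(2) \<open>c r = 0\<close> show ?thesis by (auto simp: less_Suc_eq)
    qed
    then show ?case using p(1) s(1) by (intro exI[of _ q]) (auto simp: q_def less_Suc_eq)
  qed
  then show ?thesis by blast
qed

text \<open>The set that \<open>polytope_n\<close> describes, so that a polytope is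
  \<open>hull_n S\<close> for a finite \<open>S\<close>.\<close>

definition hull_n :: "vec set \<Rightarrow> vec set" where
  "hull_n S = {x. \<exists>w. (\<forall>s\<in>S. 0 \<le> w s) \<and> sum w S = 1 \<and> x = (\<lambda>i. \<Sum>s\<in>S. w s * s i)}"

lemma hull_superset:
  assumes "finite S"
  shows "S \<subseteq> hull_n S"
proof
  fix x assume x: "x \<in> S"
  have *: "(\<Sum>s\<in>S. (if s = x then 1 else 0) * f s) = f x" for f :: "vec \<Rightarrow> real"
    using assms x by (simp add: if_distrib[of "\<lambda>x. x * _"] cong: if_cong)
  show "x \<in> hull_n S" unfolding hull_n_def
    using *[of "\<lambda>_. 1"] *[of "\<lambda>s. s i" for i]
    by (intro CollectI exI[of _ "\<lambda>s. if s = x then 1 else 0"]) auto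
qed

lemma hull_Rn: "S \<subseteq> Rn n \<Longrightarrow> hull_n S \<subseteq> Rn n"
  by (auto simp: hull_n_def Rn_def subset_iff intro!: sum.neutral)

lemma hull_convex:
  assumes "x \<in> hull_n S" "y \<in> hull_n S" "0 \<le> u" "u \<le> 1"
  shows "(\<lambda>i. u * x i + (1 - u) * y i) \<in> hull_n S"
proof -
  obtain w where w: "\<forall>s\<in>S. 0 \<le> w s" "sum w S = 1" "x = (\<lambda>i. \<Sum>s\<in>S. w s * s i)"
    using assms(1) unfolding hull_n_def by blast
  obtain v where v: "\<forall>s\<in>S. 0 \<le> v s" "sum v S = 1" "y = (\<lambda>i. \<Sum>s\<in>S. v s * s i)"
    using assms(2) unfolding hull_n_def by blast
  show ?thesis unfolding hull_n_def
  proof (intro CollectI exI conjI)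
    show "\<forall>s\<in>S. 0 \<le> u * w s + (1 - u) * v s" using w(1) v(1) assms by simp
    show "(\<Sum>s\<in>S. u * w s + (1 - u) * v s) = 1"
      by (simp only: sum.distrib sum_distrib_left[symmetric] w(2) v(2)) simp
    show "(\<lambda>i. u * x i + (1 - u) * y i) = (\<lambda>i. \<Sum>s\<in>S. (u * w s + (1 - u) * v s) * s i)"
      unfolding w(3) v(3) by (simp only: distrib_right sum.distrib sum_distrib_left mult.assoc)
  qed
qed

lemma hull_ip_le:
  assumes "x \<in> hull_n S" "\<And>s. s \<in> S \<Longrightarrow> ip n a s \<le> b"
  shows "ip n a x \<le> b"
proof -
  obtain w where w: "\<forall>s\<in>S. 0 \<le> w s" "sum w S = 1" "x = (\<lambda>i. \<Sum>s\<in>S. w s * s i)"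
    using assms unfolding hull_n_def by blast
  have "ip n a x = (\<Sum>s\<in>S. w s * ip n a s)" unfolding w(3) by (rule ip_sum_right)
  also have "\<dots> \<le> (\<Sum>s\<in>S. w s * b)" using w assms by (intro sum_mono mult_left_mono) auto
  also have "\<dots> = b" using w by (simp add: sum_distrib_right[symmetric])
  finally show ?thesis .
qed

text \<open>The slacks \<open>b - ip n a s\<close> are nonnegative, so a convex combination attains
  \<open>b\<close> only if every point of positive weight does.\<close>

lemma hull_face:
  assumes "finite S" "\<And>s. s \<in> S \<Longrightarrow> ip n a s \<le> b"
  shows "{x \<in> hull_n S. ip n a x = b} = hull_n {s \<in> S. ip n a s = b}" (is "?L = ?R")
proof
  show "?R \<subseteq> ?L"
  proof
    fix x assume "x \<in> ?R"
    then obtain w where w: "\<forall>s\<in>{s \<in> S. ip n a s = b}. 0 \<le> w s" "sum w {s \<in> S. ip n a s = b} = 1"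
      "x = (\<lambda>i. \<Sum>s\<in>{s \<in> S. ip n a s = b}. w s * s i)" unfolding hull_n_def by blast
    have "ip n a x = (\<Sum>s\<in>{s \<in> S. ip n a s = b}. w s * ip n a s)" unfolding w(3) by (rule ip_sum_right)
    also have "\<dots> = b" using w by (simp add: sum_distrib_right[symmetric])
    finally have 1: "ip n a x = b" .
    have "x \<in> hull_n S" unfolding hull_n_def
    proof (intro CollectI exI conjI)
      let ?v = "\<lambda>s. if ip n a s = b then w s else 0"
      show "\<forall>s\<in>S. 0 \<le> ?v s" using w by auto
      show "sum ?v S = 1" using w assms(1) by (simp add: sum.inter_filter)
      show "x = (\<lambda>i. \<Sum>s\<in>S. ?v s * s i)" unfolding w(3) using assms(1)
        by (simp add: sum.inter_filter if_distrib[of "\<lambda>x. x * _"] cong: if_cong)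
    qed
    with 1 show "x \<in> ?L" by simp
  qed
  show "?L \<subseteq> ?R"
  proof
    fix x assume x: "x \<in> ?L"
    then obtain w where w: "\<forall>s\<in>S. 0 \<le> w s" "sum w S = 1" "x = (\<lambda>i. \<Sum>s\<in>S. w s * s i)"
      unfolding hull_n_def by blast
    have b: "(\<Sum>s\<in>S. w s * ip n a s) = b" using x unfolding w(3) by (simp add: ip_sum_right)
    then have "(\<Sum>s\<in>S. w s * (b - ip n a s)) = b * sum w S - b"
      using b by (simp add: right_diff_distrib sum_subtractf sum_distrib_left mult.commute[of b])
    then have "(\<Sum>s\<in>S. w s * (b - ip n a s)) = 0" using w(2) by simp
    then have "\<forall>s\<in>S. w s * (b - ip n a s) = 0" using w assms
      by (subst (asm) sum_nonneg_eq_0_iff) auto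
    then have z: "\<forall>s\<in>S - {s \<in> S. ip n a s = b}. w s = 0" by auto
    show "x \<in> ?R" unfolding hull_n_def
    proof (intro CollectI exI conjI)
      show "\<forall>s\<in>{s \<in> S. ip n a s = b}. 0 \<le> w s" using w by auto
      show "sum w {s \<in> S. ip n a s = b} = 1" unfolding w(2)[symmetric] using assms(1) z
        by (intro sum.mono_neutral_left) auto
      show "x = (\<lambda>i. \<Sum>s\<in>{s \<in> S. ip n a s = b}. w s * s i)" unfolding w(3) using assms(1) z
        by (intro ext sum.mono_neutral_right) auto
    qed
  qed
qed

text \<open>By \<open>hull_face\<close> a facet is determined by the members of \<open>S\<close> on
  it. Finiteness matters because \<open>card\<close> is 0 on infinite sets, which would spoil any
  comparison with the number of facets.\<close>

lemma finite_facets: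
  assumes "finite S"
  shows "finite {F. facet_n n (hull_n S) F}"
proof (rule finite_subset)
  show "{F. facet_n n (hull_n S) F} \<subseteq> hull_n ` Pow S"
  proof
    fix F assume "F \<in> {F. facet_n n (hull_n S) F}"
    then obtain a b where "\<forall>x\<in>hull_n S. ip n a x \<le> b" "F = {x \<in> hull_n S. ip n a x = b}"
      by (auto simp: facet_n_def)
    then have "F = hull_n {s \<in> S. ip n a s = b}"
      using hull_face[OF assms, of n a b] hull_superset[OF assms] by blast
    then show "F \<in> hull_n ` Pow S" by blast
  qed
qed (use assms in simp)

section \<open>Facet representation of polytopes\<close>

text \<open>Tychonoff's theorem. The index type is arbitrary because the lemma serves both for
  coordinates and for weights indexed by points.\<close>

lemma compact_box:
  fixes l u :: "'a \<Rightarrow> real"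
  shows "compact {x. \<forall>i. l i \<le> x i \<and> x i \<le> u i}"
proof -
  have "compactin (product_topology (\<lambda>i. euclidean) UNIV) (\<Pi>\<^sub>E i\<in>UNIV. {l i..u i})"
    unfolding compactin_PiE by auto
  moreover have "(\<Pi>\<^sub>E i\<in>UNIV. {l i..u i}) = {x. \<forall>i. l i \<le> x i \<and> x i \<le> u i}"
    by (auto simp: PiE_def)
  ultimately show ?thesis by (simp add: euclidean_product_topology)
qed

lemma hull_compact:
  assumes "finite S"
  shows "compact (hull_n S)"
proof -
  \<comment> \<open>Pinning the weights to 0 off \<open>S\<close> makes the simplex of weights a
    closed part of a compact box; the hull is its continuous image.\<close>
  let ?W = "{w :: vec \<Rightarrow> real. \<forall>s. 0 \<le> w s \<and> w s \<le> (if s \<in> S then 1 else 0)} \<inter> {w. sum w S = 1}"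
  have "hull_n S = (\<lambda>w i. \<Sum>s\<in>S. w s * s i) ` ?W"
  proof
    show "hull_n S \<subseteq> (\<lambda>w i. \<Sum>s\<in>S. w s * s i) ` ?W"
    proof
      fix x assume "x \<in> hull_n S"
      then obtain w where w: "\<forall>s\<in>S. 0 \<le> w s" "sum w S = 1" "x = (\<lambda>i. \<Sum>s\<in>S. w s * s i)"
        unfolding hull_n_def by blast
      define v where "v = (\<lambda>s. if s \<in> S then w s else 0)"
      have "w s \<le> 1" if "s \<in> S" for s
        using member_le_sum[of s S w] w that assms by simp
      then have "v \<in> ?W" using w by (auto simp: v_def)
      moreover have "x = (\<lambda>i. \<Sum>s\<in>S. v s * s i)" unfolding w(3) v_def by auto
      ultimately show "x \<in> (\<lambda>w i. \<Sum>s\<in>S. w s * s i) ` ?W" by blast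
    qed
    show "(\<lambda>w i. \<Sum>s\<in>S. w s * s i) ` ?W \<subseteq> hull_n S" by (auto simp: hull_n_def)
  qed
  moreover have "compact ?W"
    by (intro compact_Int_closed compact_box closed_Collect_eq continuous_intros) auto
  moreover have "continuous_on ?W (\<lambda>w i. \<Sum>s\<in>S. w s * s i)"
    by (intro continuous_on_coordinatewise_then_product continuous_intros continuous_on_subset[OF continuous_on_product_coordinates]) auto
  ultimately show ?thesis by (simp add: compact_continuous_image)
qed

section \<open>Separation of a point from a hull\<close>

lemma ip_self_pos: "x \<in> Rn n \<Longrightarrow> x \<noteq> (\<lambda>_. 0) \<Longrightarrow> 0 < ip n x x"
proof -
  assume x: "x \<in> Rn n" "x \<noteq> (\<lambda>_. 0)"
  then obtain i where i: "x i \<noteq> 0" by auto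
  with x have "i < n" by (metis (mono_tags, lifting) Rn_def mem_Collect_eq not_le)
  with i show ?thesis unfolding ip_def by (intro sum_pos2[of _ i]) (auto simp: zero_less_mult_iff)
qed

text \<open>The normal points from the nearest point \<open>q\<close> of the hull to
  \<open>p\<close>. If some \<open>s\<close> lay beyond \<open>q\<close> in this direction, a short
  move from \<open>q\<close> towards \<open>s\<close> would come closer to \<open>p\<close>.\<close>

lemma hull_separation:
  assumes S: "finite S" "S \<subseteq> Rn n" "S \<noteq> {}" and p: "p \<in> Rn n" "p \<notin> hull_n S"
  shows "\<exists>a\<in>Rn n. \<exists>b. a \<noteq> (\<lambda>_. 0) \<and> (\<forall>s\<in>S. ip n a s \<le> b) \<and> b < ip n a p"
proof -
  let ?f = "\<lambda>q. ip n (\<lambda>i. p i - q i) (\<lambda>i. p i - q i)"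
  have "continuous_on (hull_n S) ?f" unfolding ip_def
    by (intro continuous_intros continuous_on_subset[OF continuous_on_product_coordinates]) auto
  moreover have "hull_n S \<noteq> {}" using S hull_superset by blast
  ultimately obtain q where q: "q \<in> hull_n S" "\<forall>x\<in>hull_n S. ?f q \<le> ?f x"
    using continuous_attains_inf[OF hull_compact[OF S(1)]] by blast
  define a where "a = (\<lambda>i. p i - q i)"
  have qR: "q \<in> Rn n" using q hull_Rn S by blast
  then have aR: "a \<in> Rn n" using p by (auto simp: a_def Rn_def)
  have "a \<noteq> (\<lambda>_. 0)"
  proof
    assume "a = (\<lambda>_. 0)"
    then have "p = q" by (auto simp: a_def fun_eq_iff)
    with p q show False by simp
  qed
  then have "0 < ip n a a" using ip_self_pos aR by blast
  then have 1: "ip n a q < ip n a p"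
    using ip_diff_right[of n a p q] by (simp add: a_def[symmetric])
  have "ip n a s \<le> ip n a q" if s: "s \<in> S" for s
  proof (rule ccontr)
    assume neg: "\<not> ?thesis"
    define e where "e = (\<lambda>i. s i - q i)"
    have pos: "0 < ip n a e" using neg by (simp add: e_def ip_simps)
    \<comment> \<open>Short enough that the quadratic term of the squared distance does not outweigh
      the linear gain; the \<open>1 +\<close> keeps the denominator positive.\<close>
    define u where "u = min 1 (ip n a e / (1 + ip n e e))"
    have ee: "0 \<le> ip n e e" by (simp add: ip_def sum_nonneg)
    have u: "0 < u" "u \<le> 1" using pos ee by (auto simp: u_def)
    have "(\<lambda>i. u * s i + (1 - u) * q i) \<in> hull_n S"
      using hull_convex q hull_superset[OF S(1)] s u by (meson less_imp_le subsetD)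
    moreover have "(\<lambda>i. p i - (u * s i + (1 - u) * q i)) = (\<lambda>i. a i - u * e i)"
      by (auto simp: a_def e_def algebra_simps)
    ultimately have "ip n a a \<le> ip n (\<lambda>i. a i - u * e i) (\<lambda>i. a i - u * e i)"
      using q(2) unfolding a_def by fastforce
    also have "\<dots> = ip n a a - 2 * u * ip n a e + u * (u * ip n e e)"
      by (simp add: ip_def algebra_simps sum.distrib sum_subtractf sum_distrib_left)
    finally have "u * (2 * ip n a e) \<le> u * (u * ip n e e)" by (simp add: algebra_simps)
    then have "2 * ip n a e \<le> u * ip n e e" using u by simp
    also have "\<dots> \<le> ip n a e / (1 + ip n e e) * ip n e e"
      using ee by (intro mult_right_mono) (auto simp: u_def)
    also have "\<dots> \<le> ip n a e" using pos ee by (simp add: field_simps)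
    finally show False using pos by simp
  qed
  with aR 1 \<open>a \<noteq> _\<close> show ?thesis by blast
qed

text \<open>The polar of \<open>hull_n S\<close> about the interior point \<open>c\<close> is bounded, so a separating functional can be pushed
  along directions orthogonal to its active points until these span; then it defines a facet.\<close>

lemma facet_representation:
  assumes S: "finite S" "S \<subseteq> Rn n" and n: "0 < n" and c: "c \<in> Rn n" and r: "0 < r"
    and ball: "\<And>i t. i < n \<Longrightarrow> \<bar>t\<bar> = r \<Longrightarrow> (\<lambda>j. c j + (if j = i then t else 0)) \<in> hull_n S"
  shows "\<exists>E. finite E \<and> card E \<le> card {F. facet_n n (hull_n S) F} \<and>
    (\<forall>a\<in>E. \<forall>x\<in>hull_n S. ip n a x \<le> 1 + ip n a c) \<and>
    (\<forall>x\<in>Rn n. (\<forall>a\<in>E. ip n a x \<le> 1 + ip n a c) \<longrightarrow> x \<in> hull_n S)"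
proof -
  \<comment> \<open>With inequalities normalised to \<open>ip n a (x - c) \<le> 1\<close>,
    \<open>Q\<close> is the polar of the hull moved by \<open>-c\<close>. The points active at
    \<open>a\<close> span, seen from \<open>c\<close>, exactly when \<open>a\<close> is a vertex of
    \<open>Q\<close>; so \<open>E\<close> is the vertex set of the polar, which should match the
    facets.\<close>
  define sp where "sp = (\<lambda>A. \<forall>d\<in>Rn n. (\<forall>s\<in>A. ip n d s = ip n d c) \<longrightarrow> d = (\<lambda>_. 0))"
  define act where "act = (\<lambda>a. {s \<in> S. ip n a s = 1 + ip n a c})"
  define Q where "Q = {a \<in> Rn n. \<forall>s\<in>S. ip n a s \<le> 1 + ip n a c}"
  define E where "E = {a \<in> Q. sp (act a)}"
  define face where "face = (\<lambda>a. {x \<in> hull_n S. ip n a x = 1 + ip n a c})"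
  have Sne: "S \<noteq> {}" using ball[OF n, of r] r by (auto simp: hull_n_def)
  have Qle: "ip n a x \<le> 1 + ip n a c" if "a \<in> Q" "x \<in> hull_n S" for a x
    using that hull_ip_le[of x S n a] by (auto simp: Q_def)
  \<comment> \<open>As \<open>c\<close> is an interior point, no nonzero functional is maximal
    there. This is the boundedness of the polar.\<close>
  have up: "\<exists>s\<in>S. ip n d c < ip n d s" if d: "d \<in> Rn n" "d \<noteq> (\<lambda>_. 0)" for d
  proof (rule ccontr)
    assume "\<not> ?thesis"
    then have *: "ip n d x \<le> ip n d c" if "x \<in> hull_n S" for x
      using hull_ip_le[OF that, of n d "ip n d c"] by force
    obtain i where "d i \<noteq> 0" using d by auto
    with d have i: "i < n" by (metis (mono_tags, lifting) Rn_def mem_Collect_eq not_le)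
    have "ip n d (\<lambda>j. c j + (if j = i then sgn (d i) * r else 0)) = ip n d c + \<bar>d i\<bar> * r"
      using i by (simp add: ip_add_right ip_unit abs_sgn)
    moreover have "\<bar>sgn (d i) * r\<bar> = r" using r \<open>d i \<noteq> 0\<close> by (simp add: abs_mult sgn_if)
    ultimately have "\<bar>d i\<bar> * r \<le> 0" using *[OF ball[OF i]] by fastforce
    then show False using r \<open>d i \<noteq> 0\<close> by (simp add: mult_le_0_iff)
  qed
  have inj: "inj_on face E"
  proof (rule inj_onI)
    fix a a' assume a: "a \<in> E" "a' \<in> E" "face a = face a'"
    define d where "d = (\<lambda>i. a i - a' i)"
    have "ip n d s = ip n d c" if "s \<in> act a" for s
    proof -
      have "s \<in> face a" "s \<in> face a'"
        using that hull_superset[OF S(1)] unfolding a(3)[symmetric] by (auto simp: act_def face_def)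
      then show ?thesis by (simp add: face_def d_def ip_simps)
    qed
    moreover have "d \<in> Rn n" using a by (auto simp: E_def Q_def d_def Rn_def)
    ultimately have "d = (\<lambda>_. 0)" using a(1) by (auto simp: E_def sp_def)
    then show "a = a'" by (simp add: d_def fun_eq_iff)
  qed
  have facets: "facet_n n (hull_n S) (face a)" if a: "a \<in> E" for a
  proof -
    \<comment> \<open>An empty active set would not span, and at an active point
      \<open>a = 0\<close> would give \<open>0 = 1\<close>.\<close>
    have "(\<lambda>i. if i = 0 then 1 else 0) \<in> Rn n" "(\<lambda>i::nat. if i = 0 then 1 else 0::real) \<noteq> (\<lambda>_. 0)"
      using n by (auto simp: Rn_def fun_eq_iff)
    then have "act a \<noteq> {}" using a by (auto simp: E_def sp_def)
    then have "\<exists>i<n. a i \<noteq> 0" by (rule_tac ccontr) (auto simp: act_def ip_def)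
    have "\<exists>p :: nat \<Rightarrow> vec. (\<forall>i<n. p i \<in> (\<lambda>s i. s i - c i) ` act a) \<and>
      (\<forall>c. (\<forall>j<n. (\<Sum>i<n. c i * p i j) = 0) \<longrightarrow> (\<forall>i<n. c i = 0))"
      using a by (intro spanning_imp_independent) (auto simp: E_def sp_def ip_simps)
    then obtain p where p: "\<forall>i<n. p i \<in> (\<lambda>s i. s i - c i) ` act a"
      "\<And>c. (\<forall>j<n. (\<Sum>i<n. c i * p i j) = 0) \<Longrightarrow> (\<forall>i<n. c i = 0)" by blast
    define q where "q = (\<lambda>i j. p i j + c j)"
    have "q i \<in> face a" if i: "i < n" for i
    proof -
      obtain s where "s \<in> act a" "p i = (\<lambda>i. s i - c i)" using p i by blast
      then show ?thesis using hull_superset[OF S(1)] by (auto simp: q_def act_def face_def)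
    qed
    moreover have "\<forall>i\<in>{1..<n}. e i = 0"
      if e: "\<forall>j<n. (\<Sum>i\<in>{1..<n}. e i * (q i j - q 0 j)) = 0" for e
    proof -
      \<comment> \<open>An affine relation among the \<open>q i\<close> is a linear relation among
        the \<open>p i\<close>, with minus the sum of the coefficients at index 0.\<close>
      define e' where "e' = (\<lambda>i. if i = 0 then - (\<Sum>i\<in>{1..<n}. e i) else e i)"
      have "(\<Sum>i<n. e' i * p i j) = 0" if "j < n" for j
      proof -
        have "{..<n} = insert 0 {1..<n}" using n by auto
        then have "(\<Sum>i<n. e' i * p i j) = e' 0 * p 0 j + (\<Sum>i\<in>{1..<n}. e' i * p i j)" by simp
        also have "(\<Sum>i\<in>{1..<n}. e' i * p i j) = (\<Sum>i\<in>{1..<n}. e i * p i j)"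
          by (intro sum.cong) (auto simp: e'_def)
        also have "e' 0 * p 0 j + \<dots> = (\<Sum>i\<in>{1..<n}. e i * (q i j - q 0 j))"
          by (simp add: e'_def q_def sum_distrib_right right_diff_distrib sum_subtractf)
        finally show ?thesis using e that by simp
      qed
      then have "\<forall>i<n. e' i = 0" using p(2) by blast
      then show ?thesis by (auto simp: e'_def split: if_splits)
    qed
    ultimately have ind: "\<exists>q :: nat \<Rightarrow> vec. (\<forall>i<n. q i \<in> face a) \<and>
        (\<forall>e :: nat \<Rightarrow> real. (\<forall>j<n. (\<Sum>i\<in>{1..<n}. e i * (q i j - q 0 j)) = 0)
            \<longrightarrow> (\<forall>i\<in>{1..<n}. e i = 0))" by blast
    have "a \<in> Q" "a \<in> Rn n" using a by (auto simp: E_def Q_def)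
    then have "\<forall>x\<in>hull_n S. ip n a x \<le> 1 + ip n a c" using Qle by blast
    with \<open>a \<in> Rn n\<close> \<open>\<exists>i<n. a i \<noteq> 0\<close> ind show ?thesis
      unfolding facet_n_def face_def by blast
  qed
  have "face ` E \<subseteq> {F. facet_n n (hull_n S) F}" using facets by auto
  then have card: "finite E" "card E \<le> card {F. facet_n n (hull_n S) F}"
    using inj finite_facets[OF S(1), of n] by (auto intro: inj_on_finite card_inj_on_le)
  have "x \<in> hull_n S" if x: "x \<in> Rn n" "\<forall>a\<in>E. ip n a x \<le> 1 + ip n a c" for x
  proof (rule ccontr)
    assume "x \<notin> hull_n S"
    from hull_separation[OF S Sne x(1) this] obtain a b where
      a: "a \<in> Rn n" "a \<noteq> (\<lambda>_. 0)" "\<forall>s\<in>S. ip n a s \<le> b" "b < ip n a x" by blast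
    \<comment> \<open>Dividing by the slack at \<open>c\<close>, positive by \<open>up\<close>,
      normalises the separating functional into \<open>Q\<close>.\<close>
    define D where "D = b - ip n a c"
    have "0 < D" using up[OF a(1,2)] a(3) by (force simp: D_def)
    define a' where "a' = (\<lambda>i. 1 / D * a i)"
    have ip': "ip n a' y = ip n a y / D" for y unfolding a'_def ip_scale_left by simp
    have c': "1 + ip n a' c = b / D"
    proof -
      have "1 + ip n a' c = (D + ip n a c) / D" using \<open>0 < D\<close> by (simp add: ip' add_divide_distrib)
      then show ?thesis by (simp add: D_def)
    qed
    have "a' \<in> Rn n" using a by (auto simp: a'_def Rn_def)
    moreover have "ip n a' s \<le> 1 + ip n a' c" if "s \<in> S" for s
      unfolding c' unfolding ip' using a(3) that \<open>0 < D\<close> by (simp add: divide_right_mono)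
    moreover have "1 + ip n a' c < ip n a' x"
      unfolding c' unfolding ip' using a(4) \<open>0 < D\<close> by (simp add: divide_strict_right_mono)
    ultimately have "a' \<in> {a \<in> Q. 1 + ip n a c < ip n a x}" by (auto simp: Q_def)
    moreover have "\<forall>a. a \<in> {a \<in> Q. 1 + ip n a c < ip n a x} \<longrightarrow> card (act a) \<le> card S"
      using S by (auto simp: act_def intro: card_mono)
    ultimately obtain a where a: "a \<in> Q" "1 + ip n a c < ip n a x"
      and max: "\<And>a'. a' \<in> Q \<Longrightarrow> 1 + ip n a' c < ip n a' x \<Longrightarrow> card (act a') \<le> card (act a)"
      using ex_has_greatest_nat[of "\<lambda>a. a \<in> {a \<in> Q. 1 + ip n a c < ip n a x}" a' "\<lambda>a. card (act a)" "Suc (card S)"]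
      by (auto simp: le_imp_less_Suc less_Suc_eq_le)
    have "sp (act a)"
    proof (rule ccontr)
      assume "\<not> sp (act a)"
      then obtain d0 where d0: "d0 \<in> Rn n" "\<forall>s\<in>act a. ip n d0 s = ip n d0 c" "d0 \<noteq> (\<lambda>_. 0)"
        by (auto simp: sp_def)
      \<comment> \<open>The sign is chosen so that moving along \<open>d\<close> cannot reduce the
        violation at \<open>x\<close>.\<close>
      define sg :: real where "sg = (if ip n d0 c \<le> ip n d0 x then 1 else -1)"
      define d where "d = (\<lambda>i. sg * d0 i)"
      have "sg \<noteq> 0" by (simp add: sg_def)
      then have d: "d \<in> Rn n" "\<forall>s\<in>act a. ip n d s = ip n d c" "d \<noteq> (\<lambda>_. 0)"
        using d0 by (auto simp: d_def Rn_def ip_simps fun_eq_iff)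
      have dx: "ip n d c \<le> ip n d x" by (auto simp: d_def ip_scale_left sg_def)
      define U where "U = {s \<in> S. ip n d c < ip n d s}"
      have U: "finite U" "U \<noteq> {}" using S up[OF d(1,3)] by (auto simp: U_def)
      \<comment> \<open>A ratio test: \<open>g s\<close> is the step at which the inequality at
        \<open>s\<close> becomes tight. The least ratio stays inside \<open>Q\<close> and activates
        a new point \<open>s0\<close>, contradicting the maximal choice of \<open>a\<close>.\<close>
      define g where "g = (\<lambda>s. (1 + ip n a c - ip n a s) / (ip n d s - ip n d c))"
      define \<tau> where "\<tau> = Min (g ` U)"
      have "\<tau> \<in> g ` U" using U by (simp add: \<tau>_def)
      then obtain s0 where s0: "s0 \<in> U" "\<tau> = g s0" by blast
      have \<tau>: "0 \<le> \<tau>" using s0 a(1) by (auto simp: g_def U_def Q_def)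
      have \<tau>le: "\<tau> \<le> g s" if "s \<in> U" for s using U that by (simp add: \<tau>_def)
      define a' where "a' = (\<lambda>i. a i + \<tau> * d i)"
      have ip': "ip n a' y = ip n a y + \<tau> * ip n d y" for y by (simp add: a'_def ip_simps)
      have "ip n a' s \<le> 1 + ip n a' c" if s: "s \<in> S" for s
      proof (cases "s \<in> U")
        case True
        with \<tau>le[OF True] show ?thesis by (simp add: g_def U_def ip' pos_le_divide_eq algebra_simps)
      next
        case False
        then have "\<tau> * ip n d s \<le> \<tau> * ip n d c" using s \<tau> by (intro mult_left_mono) (auto simp: U_def)
        then show ?thesis using s a(1) by (force simp: ip' Q_def)
      qed
      then have "a' \<in> Q" using a(1) d(1) by (auto simp: Q_def a'_def Rn_def)
      moreover have "1 + ip n a' c < ip n a' x"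
        using a(2) mult_left_mono[OF dx \<tau>] by (simp add: ip')
      ultimately have le: "card (act a') \<le> card (act a)" by (rule max)
      have "act a \<subseteq> act a'" using d(2) by (auto simp: act_def ip')
      moreover have "s0 \<in> act a'"
      proof -
        have "\<tau> * (ip n d s0 - ip n d c) = 1 + ip n a c - ip n a s0"
          using s0 by (simp add: g_def U_def)
        then show ?thesis using s0(1) by (simp add: act_def U_def ip' algebra_simps)
      qed
      moreover have "s0 \<notin> act a" using d(2) s0(1) by (auto simp: U_def)
      ultimately have "act a \<subset> act a'" by blast
      then have "card (act a) < card (act a')" using S by (intro psubset_card_mono) (auto simp: act_def)
      with le show False by simp
    qed
    with a(1) have "a \<in> E" by (simp add: E_def)
    with x a(2) show False by force
  qed
  then show ?thesis using card Qle by (intro exI[of _ E]) (auto simp: E_def)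
qed

section \<open>Random signs\<close>

text \<open>This bounds the exponential moment of a random sign. For small \<open>x\<close> both
  exponentials are bounded by quadratics; for large \<open>x\<close> the square dominates
  \<open>\<bar>x\<bar>\<close>.\<close>

lemma cosh_le_exp_square: "cosh (x::real) \<le> exp (x\<^sup>2)"
proof (cases "\<bar>x\<bar> \<le> 1")
  case True
  have e: "exp y \<le> 1 + y + y\<^sup>2" if "\<bar>y\<bar> \<le> 1" for y :: real
  proof (cases "0 \<le> y")
    case True
    with that show ?thesis by (intro exp_bound) auto
  next
    case False
    define z where "z = - y"
    have z: "0 < z" "z \<le> 1" using that False by (auto simp: z_def)
    have "1 + z + z\<^sup>2 / 2 \<le> exp z" by (rule exp_lower_Taylor_quadratic) (use z in auto)
    \<comment> \<open>Multiplying with the Taylor lower bound of \<open>exp z\<close> turns this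
      into an upper bound for \<open>exp (- z)\<close>.\<close>
    moreover have "1 \<le> (1 - z + z\<^sup>2) * (1 + z + z\<^sup>2 / 2)"
    proof -
      have "(1 - z + z\<^sup>2) * (1 + z + z\<^sup>2 / 2) = 1 + z\<^sup>2 / 2 + z ^ 3 / 2 + z ^ 4 / 2"
        by (simp add: field_simps power2_eq_square power3_eq_cube power4_eq_xxxx)
      then show ?thesis using z by simp
    qed
    moreover have "0 < 1 - z + z\<^sup>2" using z by (simp add: add_nonneg_pos)
    ultimately have "1 \<le> (1 - z + z\<^sup>2) * exp z"
      by (meson less_imp_le mult_left_mono order_trans)
    then have "exp (- z) \<le> 1 - z + z\<^sup>2" by (simp add: exp_minus field_simps)
    then show ?thesis by (simp add: z_def)
  qed
  have "cosh x \<le> 1 + x\<^sup>2" using e[of x] e[of "- x"] True by (simp add: cosh_field_def)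
  also have "\<dots> \<le> exp (x\<^sup>2)" by (rule exp_ge_add_one_self)
  finally show ?thesis .
next
  case False
  have "cosh x \<le> exp \<bar>x\<bar>" by (auto simp: cosh_field_def abs_if)
  also have "\<bar>x\<bar> \<le> x\<^sup>2" using False self_le_power[of "\<bar>x\<bar>" 2] by simp
  then have "exp \<bar>x\<bar> \<le> exp (x\<^sup>2)" by simp
  finally show ?thesis .
qed

text \<open>Chernoff's method, with probabilities written as counts of sign patterns. The threshold
  is \<open>sqrt (card J) / 4\<close> standard deviations of the sum.\<close>

lemma rademacher_tail:
  fixes a :: "'a \<Rightarrow> real"
  assumes J: "finite J"
  shows "real (card {\<epsilon> \<in> J \<rightarrow>\<^sub>E {-1, 1}. L2_set a J * sqrt (card J) / 4 < (\<Sum>j\<in>J. a j * \<epsilon> j)})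
    \<le> 2 ^ card J * exp (- (card J / 64))"
proof (cases "L2_set a J = 0 \<or> J = {}")
  case True
  then have z: "(\<Sum>j\<in>J. a j * \<epsilon> j) = 0" for \<epsilon> using J by (auto simp: L2_set_eq_0_iff)
  have "\<not> L2_set a J * sqrt (card J) / 4 < 0" by (simp add: not_less)
  then have "{\<epsilon> \<in> J \<rightarrow>\<^sub>E {-1, 1}. L2_set a J * sqrt (card J) / 4 < (\<Sum>j\<in>J. a j * \<epsilon> j)} = {}"
    unfolding z by blast
  then show ?thesis by (simp only: card.empty) simp
next
  case False
  define A where "A = L2_set a J"
  define M where "M = sqrt (card J)"
  \<comment> \<open>The minimiser of \<open>l\<^sup>2 * A\<^sup>2 - l * A * M / 4\<close>, with
    minimum \<open>- M\<^sup>2 / 64\<close>.\<close>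
  define l where "l = M / (8 * A)"
  let ?S = "J \<rightarrow>\<^sub>E {-1, 1::real}"
  let ?B = "{\<epsilon> \<in> ?S. A * M / 4 < (\<Sum>j\<in>J. a j * \<epsilon> j)}"
  have A: "0 < A" using False by (simp add: A_def less_le)
  have M: "0 < M" "M\<^sup>2 = card J" using False J by (auto simp: M_def card_gt_0_iff)
  have l: "0 < l" using A M by (simp add: l_def)
  have fin: "finite ?S" using J by (intro finite_PiE) auto
  have sq: "(\<Sum>j\<in>J. (a j)\<^sup>2) = A\<^sup>2" by (simp add: A_def L2_set_def sum_nonneg)
  have "real (card ?B) * exp (M\<^sup>2 / 32) = (\<Sum>\<epsilon>\<in>?B. exp (M\<^sup>2 / 32))" by simp
  also have "\<dots> \<le> (\<Sum>\<epsilon>\<in>?B. exp (l * (\<Sum>j\<in>J. a j * \<epsilon> j)))"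
  proof (rule sum_mono)
    fix \<epsilon> assume "\<epsilon> \<in> ?B"
    then have "l * (A * M / 4) \<le> l * (\<Sum>j\<in>J. a j * \<epsilon> j)" using l by (intro mult_left_mono) auto
    also have "l * (A * M / 4) = M\<^sup>2 / 32" using A by (simp add: l_def power2_eq_square)
    finally show "exp (M\<^sup>2 / 32) \<le> exp (l * (\<Sum>j\<in>J. a j * \<epsilon> j))" by simp
  qed
  also have "\<dots> \<le> (\<Sum>\<epsilon>\<in>?S. exp (l * (\<Sum>j\<in>J. a j * \<epsilon> j)))"
    using fin by (intro sum_mono2) auto
  also have "\<dots> = (\<Sum>\<epsilon>\<in>?S. \<Prod>j\<in>J. exp (l * a j * \<epsilon> j))"
    using J by (simp add: sum_distrib_left exp_sum mult.assoc)
  \<comment> \<open>Independence of the signs: the sum over all patterns factorises.\<close>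
  also have "\<dots> = (\<Prod>j\<in>J. \<Sum>e\<in>{-1, 1}. exp (l * a j * e))"
    using J by (intro prod_sum_PiE[symmetric]) auto
  also have "\<dots> = (\<Prod>j\<in>J. 2 * cosh (l * a j))"
    by (intro prod.cong) (auto simp: cosh_field_def)
  also have "\<dots> \<le> (\<Prod>j\<in>J. 2 * exp ((l * a j)\<^sup>2))"
    using cosh_le_exp_square by (intro prod_mono) auto
  also have "\<dots> = 2 ^ card J * exp (\<Sum>j\<in>J. (l * a j)\<^sup>2)"
    using J by (simp add: prod.distrib exp_sum)
  also have "(\<Sum>j\<in>J. (l * a j)\<^sup>2) = M\<^sup>2 / 64"
  proof -
    have "(\<Sum>j\<in>J. (l * a j)\<^sup>2) = l\<^sup>2 * A\<^sup>2" by (simp add: power_mult_distrib sum_distrib_left[symmetric] sq)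
    then show ?thesis using A by (simp add: l_def field_simps)
  qed
  finally have "real (card ?B) \<le> 2 ^ card J * (exp (M\<^sup>2 / 64) / exp (M\<^sup>2 / 32))"
    by (simp add: field_simps)
  also have "exp (M\<^sup>2 / 64) / exp (M\<^sup>2 / 32) = exp (- (M\<^sup>2 / 64))" by (simp add: exp_diff[symmetric])
  finally show ?thesis using M(2) by (simp add: A_def M_def)
qed

text \<open>A union bound: each functional excludes at most the fraction
  \<open>exp (- (card J / 64))\<close> of the patterns, and there are too few functionals to exclude
  all.\<close>

lemma ex_good_signs:
  fixes E :: "('a \<Rightarrow> real) set"
  assumes J: "finite J" and E: "finite E" "real (card E) < exp (card J / 64)"
  shows "\<exists>\<epsilon>. (\<forall>j\<in>J. \<bar>\<epsilon> j\<bar> = 1) \<and>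
    (\<forall>a\<in>E. (\<Sum>j\<in>J. a j * \<epsilon> j) \<le> L2_set a J * sqrt (card J) / 4)"
proof -
  let ?S = "J \<rightarrow>\<^sub>E {-1, 1::real}"
  let ?B = "\<lambda>a. {\<epsilon> \<in> ?S. L2_set a J * sqrt (card J) / 4 < (\<Sum>j\<in>J. a j * \<epsilon> j)}"
  have "real (card (\<Union>a\<in>E. ?B a)) \<le> (\<Sum>a\<in>E. real (card (?B a)))"
    unfolding of_nat_sum[symmetric] of_nat_le_iff by (rule card_UN_le[OF E(1)])
  also have "\<dots> \<le> (\<Sum>a\<in>E. 2 ^ card J * exp (- (card J / 64)))"
    by (intro sum_mono rademacher_tail J)
  also have "\<dots> = 2 ^ card J * (card E * exp (- (card J / 64)))" by simp
  also have "\<dots> < 2 ^ card J * 1"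
    using E(2) by (intro mult_strict_left_mono) (auto simp: exp_minus field_simps)
  also have "\<dots> = card ?S" using J by (simp add: card_PiE)
  finally have "(\<Union>a\<in>E. ?B a) \<noteq> ?S" by auto
  then obtain \<epsilon> where e: "\<epsilon> \<in> ?S" "\<forall>a\<in>E. \<epsilon> \<notin> ?B a" by blast
  then show ?thesis by (intro exI[of _ \<epsilon>]) (force simp: PiE_iff not_less)
qed

section \<open>The truncated product of cones\<close>

text \<open>Coordinates below \<open>k\<close> are the heights of the cones; the others are dealt
  out by residue mod \<open>k\<close>, so that all cones have nearly equal dimension.\<close>

definition block :: "nat \<Rightarrow> nat \<Rightarrow> nat \<Rightarrow> nat set" where
  "block n k i = {j. k \<le> j \<and> j < n \<and> j mod k = i}"

definition cone_body :: "nat \<Rightarrow> nat \<Rightarrow> vec set" where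
  "cone_body n k = {x \<in> Rn n. (\<forall>i<k. L2_set x (block n k i) \<le> x i) \<and> (\<Sum>i<k. x i) \<le> 1}"

lemma finite_block [simp]: "finite (block n k i)"
  by (rule finite_subset[of _ "{..<n}"]) (auto simp: block_def)

text \<open>Block \<open>i\<close> contains \<open>i + k\<close>, ...,
  \<open>i + m * k\<close>.\<close>

lemma card_block:
  assumes "i < k" "(m + 1) * k \<le> n"
  shows "m \<le> card (block n k i)"
proof -
  have "(\<lambda>l. (l + 1) * k + i) ` {..<m} \<subseteq> block n k i"
  proof
    fix j assume "j \<in> (\<lambda>l. (l + 1) * k + i) ` {..<m}"
    then obtain l where l: "l < m" "j = (l + 1) * k + i" by blast
    have "(l + 2) * k \<le> (m + 1) * k" using l by (intro mult_right_mono) auto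
    then have "j < n" using assms l by simp
    moreover have "j mod k = i" unfolding l(2) using assms by (subst mod_mult_self3) simp
    ultimately show "j \<in> block n k i" using l by (simp add: block_def)
  qed
  moreover have "inj_on (\<lambda>l. (l + 1) * k + i) {..<m}" using assms by (auto simp: inj_on_def)
  ultimately have "card {..<m} \<le> card (block n k i)" by (intro card_inj_on_le) auto
  then show ?thesis by simp
qed

section \<open>Boundedness, compactness and convexity of the body\<close>

lemma abs_le_L2_set: "finite A \<Longrightarrow> j \<in> A \<Longrightarrow> \<bar>x j\<bar> \<le> L2_set x A"
  using member_le_L2_set[of A j "\<lambda>j. \<bar>x j\<bar>"] by (simp add: L2_set_def)

lemma inner_le_L2_set: "(\<Sum>j\<in>A. x j * y j) \<le> L2_set x A * L2_set y A"
proof -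
  have "(\<Sum>j\<in>A. x j * y j) \<le> (\<Sum>j\<in>A. \<bar>x j\<bar> * \<bar>y j\<bar>)"
    by (intro sum_mono) (metis abs_ge_self abs_mult)
  then show ?thesis using L2_set_mult_ineq[of x y A] by linarith
qed

lemma cone_body_nonneg: "x \<in> cone_body n k \<Longrightarrow> i < k \<Longrightarrow> 0 \<le> x i"
  unfolding cone_body_def using L2_set_nonneg order_trans by blast

lemma cone_body_bound:
  assumes "x \<in> cone_body n k" "0 < k"
  shows "\<bar>x j\<bar> \<le> 1"
proof -
  have 1: "\<bar>x i\<bar> \<le> 1" if "i < k" for i
  proof -
    have "x i \<le> (\<Sum>i<k. x i)"
      using that cone_body_nonneg[OF assms(1)] by (intro member_le_sum) auto
    then show ?thesis using that cone_body_nonneg[OF assms(1)] assms by (simp add: cone_body_def)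
  qed
  consider "j < k" | "n \<le> j" | "k \<le> j" "j < n" by linarith
  then show ?thesis
  proof cases
    case 2 then show ?thesis using assms by (simp add: cone_body_def Rn_def)
  next
    case 3
    have "\<bar>x j\<bar> \<le> L2_set x (block n k (j mod k))"
      using 3 by (intro abs_le_L2_set) (auto simp: block_def)
    also have "\<dots> \<le> x (j mod k)" using assms by (simp add: cone_body_def)
    also have "\<dots> \<le> 1" using 1[of "j mod k"] assms by simp
    finally show ?thesis .
  qed (use 1 in simp)
qed

lemma compact_cone_body:
  assumes "0 < k"
  shows "compact (cone_body n k)"
proof -
  have coord: "continuous_on UNIV (\<lambda>x::vec. x i)" for i by simp
  have "closed (cone_body n k)"
    unfolding cone_body_def Rn_def L2_set_def mem_Collect_eq
    by (intro closed_Collect_conj closed_Collect_all closed_Collect_imp closed_Collect_le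
        closed_Collect_eq continuous_intros coord open_Collect_const)
  moreover have "-1 \<le> x i \<and> x i \<le> 1" if "x \<in> cone_body n k" for x i
    using cone_body_bound[OF that assms, of i] by linarith
  then have "cone_body n k = {x. \<forall>i. -1 \<le> x i \<and> x i \<le> 1} \<inter> cone_body n k" by blast
  ultimately show ?thesis
    using compact_Int_closed[OF compact_box[of "\<lambda>_. -1" "\<lambda>_. 1"], of "cone_body n k"] by argo
qed

lemma L2_set_scale: "0 \<le> t \<Longrightarrow> L2_set (\<lambda>j. t * x j) A = t * L2_set x A"
  by (simp add: L2_set_right_distrib)

lemma convex_cone_body: "convex_n (cone_body n k)"
  unfolding convex_n_def
proof (intro ballI allI impI)
  fix x y and u :: real
  assume x: "x \<in> cone_body n k" and y: "y \<in> cone_body n k" and u: "0 \<le> u \<and> u \<le> 1"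
  have "L2_set (\<lambda>j. u * x j + (1 - u) * y j) (block n k i) \<le> u * x i + (1 - u) * y i" if "i < k" for i
  proof -
    have "L2_set (\<lambda>j. u * x j + (1 - u) * y j) (block n k i)
        \<le> L2_set (\<lambda>j. u * x j) (block n k i) + L2_set (\<lambda>j. (1 - u) * y j) (block n k i)"
      by (rule L2_set_triangle_ineq)
    also have "\<dots> = u * L2_set x (block n k i) + (1 - u) * L2_set y (block n k i)"
      using u by (simp add: L2_set_scale)
    also have "\<dots> \<le> u * x i + (1 - u) * y i"
      using x y u that by (intro add_mono mult_left_mono) (auto simp: cone_body_def)
    finally show ?thesis .
  qed
  moreover have "(\<Sum>i<k. u * x i + (1 - u) * y i) \<le> 1"
  proof -
    have "(\<Sum>i<k. u * x i + (1 - u) * y i) = u * (\<Sum>i<k. x i) + (1 - u) * (\<Sum>i<k. y i)"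
      by (simp add: sum.distrib sum_distrib_left)
    also have "\<dots> \<le> u * 1 + (1 - u) * 1"
      using x y u by (intro add_mono mult_left_mono) (auto simp: cone_body_def)
    finally show ?thesis by simp
  qed
  moreover have "(\<lambda>j. u * x j + (1 - u) * y j) \<in> Rn n" using x y by (auto simp: cone_body_def Rn_def)
  ultimately show "vadd (vscale u x) (vscale (1 - u) y) \<in> cone_body n k"
    by (simp add: cone_body_def vadd_def vscale_def)
qed

section \<open>An explicit interior point\<close>

definition cone_center :: "nat \<Rightarrow> vec" where
  "cone_center k = (\<lambda>j. if j < k then 1 / (2 * real k) else 0)"

text \<open>All heights lie between \<open>1 / (4 * k)\<close> and \<open>3 / (4 * k)\<close>, so
  they dominate the block norms and sum to at most 3/4.\<close>

lemma cone_center_nbhd: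
  assumes k: "0 < k" "k \<le> n" and y: "y \<in> Rn n"
    and near: "\<And>i. i < k \<Longrightarrow> \<bar>y i - 1 / (2 * real k)\<bar> \<le> 1 / (4 * real k)"
    and small: "\<And>i. i < k \<Longrightarrow> L2_set y (block n k i) \<le> 1 / (4 * real k)"
  shows "y \<in> cone_body n k"
proof -
  have kk: "1 / (2 * real k) = 2 * (1 / (4 * real k))" by simp
  have le: "1 / (4 * real k) \<le> y i \<and> y i \<le> 3 * (1 / (4 * real k))" if "i < k" for i
    using near[OF that] unfolding kk abs_le_iff by linarith
  have "(\<Sum>i<k. y i) \<le> (\<Sum>i<k. 3 * (1 / (4 * real k)))"
    using le by (intro sum_mono) auto
  also have "\<dots> \<le> 1" using k by simp
  finally show ?thesis using le small y by (force simp: cone_body_def)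
qed

lemma L2_set_mono_set: "finite B \<Longrightarrow> A \<subseteq> B \<Longrightarrow> L2_set x A \<le> L2_set x B"
  unfolding L2_set_def by (intro real_sqrt_le_mono sum_mono2) auto

lemma cone_center_interior:
  assumes k: "0 < k" "k \<le> n"
  shows "cone_center k \<in> interior_n n (cone_body n k)"
proof -
  let ?c = "cone_center k"
  have cR: "?c \<in> Rn n" using k by (auto simp: cone_center_def Rn_def)
  have *: "y \<in> cone_body n k" if y: "y \<in> Rn n" "dist_n n ?c y < 1 / (4 * real k)" for y
  proof (rule cone_center_nbhd[OF k y(1)])
    have d: "dist_n n ?c y = L2_set (\<lambda>j. y j - ?c j) {..<n}"
      by (simp add: dist_n_def L2_set_def power2_commute)
    fix i assume i: "i < k"
    show "\<bar>y i - 1 / (2 * real k)\<bar> \<le> 1 / (4 * real k)"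
      using abs_le_L2_set[of "{..<n}" i "\<lambda>j. y j - ?c j"] i k y(2) unfolding d by (simp add: cone_center_def)
    have "L2_set y (block n k i) = L2_set (\<lambda>j. y j - ?c j) (block n k i)"
      by (intro L2_set_cong) (auto simp: block_def cone_center_def)
    also have "\<dots> \<le> L2_set (\<lambda>j. y j - ?c j) {..<n}"
      by (intro L2_set_mono_set) (auto simp: block_def)
    finally show "L2_set y (block n k i) \<le> 1 / (4 * real k)" using y(2) unfolding d by simp
  qed
  then have "?c \<in> cone_body n k" using cR k by (simp add: dist_n_def)
  then show ?thesis using * k unfolding interior_n_def by (auto intro!: exI[of _ "1 / (4 * real k)"])
qed

lemma convex_body_cone_body:
  assumes "0 < k" "k \<le> n"
  shows "convex_body n (cone_body n k)"
  unfolding convex_body_def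
proof (intro conjI)
  show "cone_body n k \<subseteq> Rn n" by (auto simp: cone_body_def)
  show "interior_n n (cone_body n k) \<noteq> {}" using cone_center_interior[OF assms] by blast
qed (use assms compact_cone_body convex_cone_body in simp_all)

text \<open>Choose \<open>i\<close> with \<open>w = \<xi> i \<le> 1 / k\<close>, multiply all other blocks of \<open>\<xi>\<close> by \<open>1 - \<delta>\<close> and replace block \<open>i\<close> by
  \<open>4 w (1, \<theta>)\<close> with a random \<open>\<theta>\<close> of norm 2, which leaves the body. The choice \<open>(3 + \<delta>) w = \<delta>\<close> makes
  \<open>ip n a (x - \<xi>) \<le> \<delta> * ip n a (v - \<xi>)\<close> as soon as \<open>\<langle>a, \<theta>\<rangle>\<close> is at most half the norm of the block of \<open>a\<close>,
  where \<open>v\<close> maximises \<open>a\<close> on block \<open>i\<close> of the body.\<close>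

lemma cone_body_escape:
  assumes k: "4 \<le> k" "k \<le> n" and \<xi>: "\<xi> \<in> cone_body n k" "\<And>i. i < k \<Longrightarrow> 0 < \<xi> i"
    and m: "\<And>i. i < k \<Longrightarrow> m \<le> card (block n k i)"
    and E: "finite E" "real (card E) < exp (real m / 64)"
    and t: "0 < t" "t \<le> (real k - 1) / 3"
    and le: "\<And>a x. a \<in> E \<Longrightarrow> x \<in> cone_body n k \<Longrightarrow> ip n a (\<lambda>j. x j - \<xi> j) \<le> t * b a"
  shows "\<exists>x\<in>Rn n. x \<notin> cone_body n k \<and> (\<forall>a\<in>E. ip n a (\<lambda>j. x j - \<xi> j) \<le> b a)"
proof -
  have "\<exists>i<k. \<xi> i \<le> 1 / real k"
  proof (rule ccontr)
    assume "\<not> ?thesis"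
    then have "(\<Sum>i<k. 1 / real k) < (\<Sum>i<k. \<xi> i)" using k by (intro sum_strict_mono) (auto simp: lessThan_empty_iff)
    then show False using \<xi>(1) k by (simp add: cone_body_def)
  qed
  then obtain i where i: "i < k" "\<xi> i \<le> 1 / real k" by blast
  define w where "w = \<xi> i"
  define J where "J = block n k i"
  define \<delta> where "\<delta> = 3 * w / (1 - w)"
  have w: "0 < w" "w * k \<le> 1" using \<xi>(2) i k by (auto simp: w_def field_simps)
  have "w * 4 \<le> w * k" using w k by (intro mult_left_mono) auto
  then have w1: "w < 1" using w by linarith
  have \<delta>eq: "\<delta> * (1 - w) = 3 * w" using w1 by (simp add: \<delta>_def)
  have \<delta>0: "0 < \<delta>" using w w1 by (simp add: \<delta>_def)
  \<comment> \<open>Since \<open>w \<le> 1 / k\<close>, \<open>\<delta>\<close> is at most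
    \<open>3 / (k - 1)\<close>; this is where the bound on \<open>t\<close> comes from, as it yields
    \<open>\<delta> * t \<le> 1\<close>.\<close>
  have \<delta>k: "\<delta> * (real k - 1) \<le> 3"
  proof -
    have "w * (real k - 1) \<le> 1 - w" using w by (simp add: algebra_simps)
    then have "3 * (w * (real k - 1)) / (1 - w) \<le> 3" using w1 by (simp add: field_simps)
    then show ?thesis by (simp add: \<delta>_def)
  qed
  have "\<delta> * 3 \<le> \<delta> * (real k - 1)" using \<delta>0 k by (intro mult_left_mono) auto
  then have \<delta>1: "\<delta> \<le> 1" using \<delta>k by linarith
  have "\<delta> * t \<le> \<delta> * ((real k - 1) / 3)" using t \<delta>0 by (intro mult_left_mono) auto
  then have \<delta>t: "\<delta> * t \<le> 1" using \<delta>k by simp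
  have J: "finite J" "i \<notin> J" "J \<subseteq> {..<n}" using i by (auto simp: J_def block_def)
  have disj: "j \<notin> J" if "j \<in> block n k i'" "i' \<noteq> i" for i' j using that by (auto simp: J_def block_def)
  have mJ: "m \<le> card J" using m i by (simp add: J_def)
  have "exp (real m / 64) \<le> exp (card J / 64)" using mJ by simp
  then obtain \<epsilon> where \<epsilon>: "\<forall>j\<in>J. \<bar>\<epsilon> j\<bar> = 1"
    "\<forall>a\<in>E. (\<Sum>j\<in>J. a j * \<epsilon> j) \<le> L2_set a J * sqrt (card J) / 4"
    using ex_good_signs[OF J(1) E(1)] E(2) by (meson order_less_le_trans)
  show ?thesis
  proof (cases "J = {}")
    \<comment> \<open>An empty block forces \<open>m = 0\<close> and hence \<open>E\<close> empty,
      so any point outside the body will do.\<close>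
    case True
    then have "m = 0" using mJ by simp
    then have "E = {}" using E by simp
    moreover have "(\<lambda>j. if j = i then -1 else 0) \<in> Rn n" using i k by (auto simp: Rn_def)
    moreover have "(\<lambda>j. if j = i then -1 else 0) \<notin> cone_body n k" using cone_body_nonneg i by fastforce
    ultimately show ?thesis by blast
  next
    case False
    define M where "M = sqrt (card J)"
    have M: "0 < M" using False J by (simp add: M_def card_gt_0_iff)
    define \<theta> where "\<theta> = (\<lambda>j. 2 / M * \<epsilon> j)"
    have \<theta>norm: "L2_set \<theta> J = 2"
    proof -
      have "L2_set \<epsilon> J = L2_set (\<lambda>j. 1) J" unfolding L2_set_def
        using \<epsilon>(1) by (intro arg_cong[of _ _ sqrt] sum.cong) (auto simp: abs_square_eq_1)
      also have "\<dots> = M" by (simp add: L2_set_constant M_def)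
      finally show ?thesis unfolding \<theta>_def using M L2_set_scale[of "2 / M" \<epsilon> J] by simp
    qed
    have \<theta>: "(\<Sum>j\<in>J. a j * \<theta> j) \<le> L2_set a J / 2" if "a \<in> E" for a
    proof -
      have "(\<Sum>j\<in>J. a j * \<theta> j) = 2 / M * (\<Sum>j\<in>J. a j * \<epsilon> j)"
        by (simp add: \<theta>_def sum_distrib_left algebra_simps)
      also have "\<dots> \<le> 2 / M * (L2_set a J * M / 4)"
        using \<epsilon>(2) that M by (intro mult_left_mono) (auto simp: M_def)
      also have "\<dots> = L2_set a J / 2" using M by simp
      finally show ?thesis .
    qed
    have \<xi>J: "L2_set \<xi> J \<le> w" using \<xi>(1) i by (simp add: cone_body_def J_def w_def)
    \<comment> \<open>\<open>D\<close> is supported on cone \<open>i\<close> and chosen so that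
      \<open>X\<close> has height \<open>4 * w\<close> and block \<open>4 * w * \<theta>\<close>
      there, and equals \<open>(1 - \<delta>) * \<xi>\<close> elsewhere. The block norm
      \<open>8 * w\<close> exceeds the height.\<close>
    define D where "D = (\<lambda>j. if j = i then \<delta> else if j \<in> J then 4 * w * \<theta> j - (1 - \<delta>) * \<xi> j else 0)"
    define X where "X = (\<lambda>j. \<xi> j + (D j - \<delta> * \<xi> j))"
    have ip_supp: "ip n a d = a i * d i + (\<Sum>j\<in>J. a j * d j)" if "\<forall>j. j \<notin> insert i J \<longrightarrow> d j = 0" for a d
    proof -
      have "ip n a d = (\<Sum>j\<in>insert i J. a j * d j)" unfolding ip_def
        using that J i k by (intro sum.mono_neutral_right) auto
      then show ?thesis using J by simp
    qed
    have XR: "X \<in> Rn n" using \<xi>(1) J i k by (auto simp: X_def D_def Rn_def cone_body_def)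
    have "X \<notin> cone_body n k"
    proof
      assume "X \<in> cone_body n k"
      then have "L2_set X J \<le> X i" using i by (simp add: cone_body_def J_def)
      moreover have "X i = 4 * w" using \<delta>eq by (simp add: X_def D_def w_def algebra_simps)
      moreover have "L2_set X J = L2_set (\<lambda>j. 4 * w * \<theta> j) J"
        using J by (intro L2_set_cong) (auto simp: X_def D_def algebra_simps)
      moreover have "\<dots> = 4 * w * 2" using w \<theta>norm L2_set_scale[of "4 * w" \<theta> J] by simp
      ultimately show False using w by simp
    qed
    moreover have "ip n a (\<lambda>j. X j - \<xi> j) \<le> b a" if a: "a \<in> E" for a
    proof -
      define A where "A = L2_set a J"
      have A: "0 \<le> A" by (simp add: A_def)
      \<comment> \<open>The maximiser of \<open>a\<close> over cone \<open>i\<close> of the body,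
        with value \<open>a i + A\<close>. If \<open>A = 0\<close>, the convention
        \<open>x / 0 = 0\<close> makes its block vanish.\<close>
      define V where "V = (\<lambda>j. if j = i then 1 else if j \<in> J then a j / A else 0)"
      have "V \<in> cone_body n k" unfolding cone_body_def
      proof (intro CollectI conjI allI impI)
        show "V \<in> Rn n" using J i k by (auto simp: V_def Rn_def)
        show "(\<Sum>l<k. V l) \<le> 1"
        proof -
          have "(\<Sum>l<k. V l) = (\<Sum>l<k. if l = i then 1 else 0)"
            by (intro sum.cong) (auto simp: V_def J_def block_def)
          then show ?thesis using i by simp
        qed
        fix l assume l: "l < k"
        show "L2_set V (block n k l) \<le> V l"
        proof (cases "l = i")
          case True
          have "L2_set V J = L2_set (\<lambda>j. 1 / A * a j) J"
            using J by (intro L2_set_cong) (auto simp: V_def)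
          also have "\<dots> = 1 / A * A" using A L2_set_scale[of "1 / A" a J] by (simp add: A_def)
          also have "\<dots> \<le> 1" by simp
          finally show ?thesis using True by (simp add: V_def J_def)
        next
          case False
          have "L2_set V (block n k l) = 0"
            using False disj i by (intro L2_set_0') (auto simp: V_def block_def)
          moreover have "l \<notin> J" using l by (simp add: J_def block_def)
          ultimately show ?thesis using False by (simp add: V_def)
        qed
      qed
      with a have V: "ip n a (\<lambda>j. V j - \<xi> j) \<le> t * b a" by (rule le)
      \<comment> \<open>The point \<open>\<xi>\<close> itself shows that \<open>b a\<close> is
        nonnegative.\<close>
      have "ip n a (\<lambda>j. \<xi> j - \<xi> j) \<le> t * b a" using a \<xi>(1) by (rule le)
      then have "0 \<le> b a" using t by (simp add: ip_def zero_le_mult_iff)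
      have "(\<Sum>j\<in>J. (a j)\<^sup>2) = A\<^sup>2" by (simp add: A_def L2_set_def sum_nonneg)
      then have VJ: "(\<Sum>j\<in>J. a j * (a j / A)) = A"
        by (simp add: power2_eq_square sum_divide_distrib[symmetric])
      have "ip n a V = a i * V i + (\<Sum>j\<in>J. a j * V j)" by (rule ip_supp) (auto simp: V_def)
      also have "(\<Sum>j\<in>J. a j * V j) = (\<Sum>j\<in>J. a j * (a j / A))"
        using J by (intro sum.cong) (auto simp: V_def)
      finally have ipV: "ip n a V = a i + A" using VJ by (simp add: V_def)
      have "ip n a D = a i * D i + (\<Sum>j\<in>J. a j * D j)" by (rule ip_supp) (auto simp: D_def)
      also have "(\<Sum>j\<in>J. a j * D j) = (\<Sum>j\<in>J. 4 * w * (a j * \<theta> j) - (1 - \<delta>) * (a j * \<xi> j))"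
        using J by (intro sum.cong) (auto simp: D_def algebra_simps)
      also have "\<dots> = 4 * w * (\<Sum>j\<in>J. a j * \<theta> j) + (1 - \<delta>) * (\<Sum>j\<in>J. a j * (- \<xi> j))"
        by (simp add: sum_subtractf sum_distrib_left sum_negf)
      finally have ipDeq: "ip n a D = \<delta> * a i + (4 * w * (\<Sum>j\<in>J. a j * \<theta> j) + (1 - \<delta>) * (\<Sum>j\<in>J. a j * (- \<xi> j)))"
        by (simp add: D_def)
      have "(\<Sum>j\<in>J. a j * (- \<xi> j)) \<le> A * w"
      proof -
        have "(\<Sum>j\<in>J. a j * (- \<xi> j)) \<le> A * L2_set (\<lambda>j. - \<xi> j) J"
          unfolding A_def by (rule inner_le_L2_set)
        also have "L2_set (\<lambda>j. - \<xi> j) J = L2_set \<xi> J" by (simp add: L2_set_def)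
        also have "A * \<dots> \<le> A * w" using A \<xi>J by (rule mult_left_mono[rotated])
        finally show ?thesis .
      qed
      then have "\<delta> * a i + (4 * w * (\<Sum>j\<in>J. a j * \<theta> j) + (1 - \<delta>) * (\<Sum>j\<in>J. a j * (- \<xi> j)))
        \<le> \<delta> * a i + (4 * w * (A / 2) + (1 - \<delta>) * (A * w))"
        using \<theta>[OF a] w \<delta>0 \<delta>1 by (intro add_mono mult_left_mono) (auto simp: A_def)
      \<comment> \<open>By \<open>\<delta> * (1 - w) = 3 * w\<close> the block terms add up to
        \<open>\<delta> * (1 - 2 * w) * A\<close>, at most \<open>\<delta> * A\<close>.\<close>
      also have "\<dots> = \<delta> * a i + A * (3 * w) - A * (\<delta> * w)" by (simp add: algebra_simps)
      also have "\<dots> = \<delta> * a i + A * (\<delta> * (1 - w)) - A * (\<delta> * w)" by (simp only: \<delta>eq)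
      also have "\<dots> \<le> \<delta> * (a i + A)"
        using A \<delta>0 w by (simp add: algebra_simps)
      finally have ipD: "ip n a D \<le> \<delta> * ip n a V" using ipV ipDeq by simp
      have "ip n a (\<lambda>j. X j - \<xi> j) = ip n a D - \<delta> * ip n a \<xi>"
        by (simp add: X_def ip_simps)
      also have "\<dots> \<le> \<delta> * ip n a (\<lambda>j. V j - \<xi> j)" using ipD by (simp add: ip_simps algebra_simps)
      also have "\<dots> \<le> \<delta> * (t * b a)" using V \<delta>0 by (intro mult_left_mono) auto
      also have "\<dots> \<le> 1 * b a" using \<delta>t \<open>0 \<le> b a\<close> by (simp only: mult.assoc[symmetric] mult_right_mono)
      finally show ?thesis by simp
    qed
    ultimately show ?thesis using XR by blast
  qed
qed

section \<open>The barycenter of the body\<close>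

lemma measurable_coord [measurable]: "i < n \<Longrightarrow> (\<lambda>x. x i) \<in> borel_measurable (leb n)"
  using measurable_component_singleton[of i "{..<n}" "\<lambda>_. lborel :: real measure"]
  by (simp add: leb_def)

lemma emeasure_leb_box:
  assumes "\<And>i. i < n \<Longrightarrow> l i \<le> u i"
  shows "emeasure (leb n) (\<Pi>\<^sub>E i\<in>{..<n}. {l i..u i}) = ennreal (\<Prod>i<n. u i - l i)"
proof -
  interpret product_sigma_finite "\<lambda>_::nat. lborel :: real measure" by standard
  have "emeasure (leb n) (\<Pi>\<^sub>E i\<in>{..<n}. {l i..u i}) = (\<Prod>i<n. emeasure lborel {l i..u i})"
    unfolding leb_def by (rule emeasure_PiM) auto
  also have "\<dots> = (\<Prod>i<n. ennreal (u i - l i))" using assms by (intro prod.cong) auto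
  also have "\<dots> = ennreal (\<Prod>i<n. u i - l i)" using assms by (intro prod_ennreal) auto
  finally show ?thesis .
qed

lemma ip_barycenter:
  assumes meas: "(\<lambda>x. restrict x {..<n}) ` K \<in> sets (leb n)"
    and fin: "emeasure (leb n) ((\<lambda>x. restrict x {..<n}) ` K) < \<infinity>"
    and bd: "\<forall>x\<in>K. \<forall>j. \<bar>x j\<bar> \<le> B" and vol: "0 < vol n K"
  shows "integrable (leb n) (\<lambda>x. indicator ((\<lambda>x. restrict x {..<n}) ` K) x * ip n c x)"
    and "ip n c (barycenter n K) * vol n K =
      (\<integral>x. indicator ((\<lambda>x. restrict x {..<n}) ` K) x * ip n c x \<partial>leb n)"
proof -
  let ?K = "(\<lambda>x. restrict x {..<n}) ` K"
  have int: "integrable (leb n) (\<lambda>x. indicator ?K x * x j)" if j: "j < n" for j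
  proof -
    have "integrable (leb n) (\<lambda>x. indicator ?K x *\<^sub>R x j)"
      using meas fin bd j by (intro integrableI_bounded_set_indicator[where B = B]) auto
    then show ?thesis by simp
  qed
  have eq: "indicator ?K x * ip n c x = (\<Sum>j<n. c j * (indicator ?K x * x j))" for x
    unfolding ip_def sum_distrib_left by (intro sum.cong) simp_all
  show "integrable (leb n) (\<lambda>x. indicator ?K x * ip n c x)"
    unfolding eq using int by (intro Bochner_Integration.integrable_sum integrable_mult_right) auto
  have "ip n c (barycenter n K) * vol n K = (\<Sum>j<n. c j * (\<integral>x. indicator ?K x * x j \<partial>leb n))"
    using vol by (simp add: ip_def barycenter_def sum_distrib_right)
  also have "\<dots> = (\<Sum>j<n. (\<integral>x. c j * (indicator ?K x * x j) \<partial>leb n))" by simp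
  also have "\<dots> = (\<integral>x. (\<Sum>j<n. c j * (indicator ?K x * x j)) \<partial>leb n)"
    using int by (intro Bochner_Integration.integral_sum[symmetric] integrable_mult_right) auto
  finally show "ip n c (barycenter n K) * vol n K = (\<integral>x. indicator ?K x * ip n c x \<partial>leb n)"
    unfolding eq .
qed

text \<open>Averaging preserves linear inequalities, so the barycenter inherits every linear
  constraint valid on \<open>K\<close>.\<close>

lemma ip_barycenter_ge:
  assumes meas: "(\<lambda>x. restrict x {..<n}) ` K \<in> sets (leb n)"
    and fin: "emeasure (leb n) ((\<lambda>x. restrict x {..<n}) ` K) < \<infinity>"
    and bd: "\<forall>x\<in>K. \<forall>j. \<bar>x j\<bar> \<le> B" and vol: "0 < vol n K"
    and ge: "\<And>x. x \<in> K \<Longrightarrow> d \<le> ip n c x"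
  shows "d \<le> ip n c (barycenter n K)"
proof -
  let ?K = "(\<lambda>x. restrict x {..<n}) ` K"
  have "integrable (leb n) (\<lambda>x. indicator ?K x *\<^sub>R d)"
    using meas fin by (intro integrableI_bounded_set_indicator[where B = "\<bar>d\<bar>"]) auto
  then have "(\<integral>x. indicator ?K x * d \<partial>leb n) \<le> (\<integral>x. indicator ?K x * ip n c x \<partial>leb n)"
    using ip_barycenter(1)[OF meas fin bd vol, of c] ge
    by (intro integral_mono) (auto simp: indicator_def ip_def)
  also have "\<dots> = ip n c (barycenter n K) * vol n K"
    using ip_barycenter(2)[OF meas fin bd vol] by simp
  also have "(\<integral>x. indicator ?K x * d \<partial>leb n) = d * vol n K"
    using meas fin by (simp add: vol_def)
  finally show ?thesis using vol by simp
qed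

text \<open>The cone constraints are not linear, so each is tested on one supporting functional, in
  the direction of the barycenter's own block. Heights of the barycenter are positive because a box
  of positive volume in the body has heights at least \<open>r\<close>.\<close>

lemma barycenter_cone_body:
  assumes k: "0 < k" "k \<le> n"
  shows "barycenter n (cone_body n k) \<in> cone_body n k"
    and "i < k \<Longrightarrow> 0 < barycenter n (cone_body n k) i"
proof -
  let ?R = "\<lambda>x. restrict x {..<n}"
  let ?K = "?R ` cone_body n k"
  let ?b = "barycenter n (cone_body n k)"
  have space: "space (leb n) = extensional {..<n}" by (simp add: leb_def space_PiM PiE_def)
  have blk: "j < n" if "j \<in> block n k l" for j l using that by (simp add: block_def)
  have L2R: "L2_set (?R x) (block n k l) = L2_set x (block n k l)" for x l
    using blk by (intro L2_set_cong) auto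
  have sumR: "(\<Sum>l<k. ?R x l) = (\<Sum>l<k. x l)" for x :: vec using k by (intro sum.cong) auto
  \<comment> \<open>A description by conditions inside the product space, from which measurability
    can be read off.\<close>
  have K: "?K = {x \<in> space (leb n). (\<forall>l\<in>{..<k}. L2_set x (block n k l) \<le> x l) \<and> (\<Sum>l<k. x l) \<le> 1}" (is "_ = ?K'")
  proof
    show "?K \<subseteq> ?K'" using k L2R sumR by (auto simp: space cone_body_def)
    show "?K' \<subseteq> ?K"
    proof
      fix x assume x: "x \<in> ?K'"
      define y where "y = (\<lambda>j. if j < n then x j else 0)"
      have xy: "x = ?R y" using x by (auto simp: space y_def extensional_def)
      have "L2_set y (block n k l) = L2_set x (block n k l)" for l
        using blk by (intro L2_set_cong) (auto simp: y_def)
      moreover have "(\<Sum>l<k. y l) = (\<Sum>l<k. x l)" using k by (intro sum.cong) (auto simp: y_def)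
      ultimately have "y \<in> cone_body n k"
        using x k by (auto simp: cone_body_def Rn_def y_def)
      with xy show "x \<in> ?K" by blast
    qed
  qed
  have meas: "?K \<in> sets (leb n)"
    unfolding K L2_set_def using k blk
    by (intro sets.sets_Collect_conj sets.sets_Collect_finite_All' sets.sets_Collect_finite_All borel_measurable_le
        borel_measurable_sum borel_measurable_power borel_measurable_const measurable_coord
        measurable_compose[OF _ borel_measurable_sqrt]) (auto simp: lessThan_empty_iff)
  have bd: "\<forall>x\<in>cone_body n k. \<forall>j. \<bar>x j\<bar> \<le> 1" using cone_body_bound k(1) by blast
  have "-1 \<le> x j \<and> x j \<le> 1" if "x \<in> cone_body n k" for x j
    using cone_body_bound[OF that k(1), of j] by linarith
  then have "?K \<subseteq> (\<Pi>\<^sub>E j\<in>{..<n}. {-1..1})" by (auto split: if_splits)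
  moreover have "(\<Pi>\<^sub>E j\<in>{..<n}. {-1..1::real}) \<in> sets (leb n)"
    unfolding leb_def by (intro sets_PiM_I_finite) auto
  ultimately have "emeasure (leb n) ?K \<le> emeasure (leb n) (\<Pi>\<^sub>E j\<in>{..<n}. {-1..1})"
    by (intro emeasure_mono)
  also have "\<dots> < \<infinity>" by (subst emeasure_leb_box) auto
  finally have fin: "emeasure (leb n) ?K < \<infinity>" .
  define r where "r = 1 / (4 * real k)"
  have r: "0 < r" using k by (simp add: r_def)
  \<comment> \<open>Blocks in this box have l1 norm at most \<open>r\<close>, and the heights,
    between \<open>r\<close> and \<open>3 * r\<close>, sum to at most 3/4.\<close>
  define l u where "l = (\<lambda>j. if j < k then r else - r / n)" and "u = (\<lambda>j. if j < k then 3 * r else r / n)"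
  let ?B = "\<Pi>\<^sub>E j\<in>{..<n}. {l j..u j}"
  have lu: "l j < u j" for j
    using r k by (simp add: l_def u_def field_simps)
  have sub: "?B \<subseteq> ?K"
  proof
    fix x assume x: "x \<in> ?B"
    have xl: "l j \<le> x j \<and> x j \<le> u j" if "j < n" for j using x that by (auto simp: PiE_iff)
    have "L2_set x (block n k i) \<le> x i" if i: "i < k" for i
    proof -
      have "L2_set x (block n k i) \<le> (\<Sum>j\<in>block n k i. \<bar>x j\<bar>)" by (rule L2_set_le_sum_abs)
      also have "\<dots> \<le> (\<Sum>j\<in>block n k i. r / n)"
        using xl by (intro sum_mono) (force simp: block_def l_def u_def abs_le_iff)
      also have "\<dots> \<le> (\<Sum>j<n. r / n)" using r blk by (intro sum_mono2) auto
      also have "\<dots> = r" using k by simp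
      also have "\<dots> \<le> x i" using xl[of i] i k by (simp add: l_def)
      finally show ?thesis .
    qed
    moreover have "x i \<le> 3 * r" if "i < k" for i using xl[of i] that k by (simp add: u_def)
    then have "(\<Sum>i<k. x i) \<le> (\<Sum>i<k. 3 * r)" by (intro sum_mono) simp
    moreover have "(\<Sum>i<k. 3 * r) \<le> 1" using k by (simp add: r_def)
    ultimately show "x \<in> ?K" unfolding K using x by (auto simp: space PiE_def)
  qed
  have Bmeas: "?B \<in> sets (leb n)" unfolding leb_def by (intro sets_PiM_I_finite) auto
  have Bval: "emeasure (leb n) ?B = ennreal (\<Prod>j<n. u j - l j)"
    using lu by (intro emeasure_leb_box) (simp add: less_imp_le)
  have Bfin: "emeasure (leb n) ?B < \<infinity>" unfolding Bval by simp
  have "0 < (\<Prod>j<n. u j - l j)" using lu by (intro prod_pos) simp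
  then have Bpos: "0 < measure (leb n) ?B" using Bval by (simp add: measure_def)
  also have "measure (leb n) ?B \<le> vol n (cone_body n k)"
    unfolding vol_def using sub Bmeas meas fin by (intro measure_mono_fmeasurable) (auto simp: fmeasurable_def)
  finally have vol: "0 < vol n (cone_body n k)" .
  note ge = ip_barycenter_ge[OF meas fin bd vol]
  have bR: "?b \<in> Rn n" by (simp add: Rn_def barycenter_def)
  have unit: "ip n (\<lambda>j. if j = i then 1 else 0) x = x i" if "i < k" for x i
    using that k by (simp add: ip_def if_distrib[of "\<lambda>x. x * _"] cong: if_cong)
  show "?b \<in> cone_body n k"
  proof -
    have ipJ: "ip n (\<lambda>j. if j \<in> J then a j else 0) x = (\<Sum>j\<in>J. a j * x j)" if "J \<subseteq> {..<n}" for J a x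
    proof -
      have "ip n (\<lambda>j. if j \<in> J then a j else 0) x = (\<Sum>j\<in>J. (if j \<in> J then a j else 0) * x j)"
        unfolding ip_def using that by (intro sum.mono_neutral_right) auto
      then show ?thesis by simp
    qed
    have "L2_set ?b (block n k i) \<le> ?b i" if i: "i < k" for i
    proof -
      let ?J = "block n k i"
      define A where "A = L2_set ?b ?J"
      \<comment> \<open>The unit vector along the block of the barycenter, or 0 if that block
        vanishes.\<close>
      define a where "a = (\<lambda>j. 1 / A * ?b j)"
      define c where "c = (\<lambda>j. (if j = i then 1 else 0) - (if j \<in> ?J then a j else 0))"
      have cx: "ip n c x = x i - (\<Sum>j\<in>?J. a j * x j)" for x
        unfolding c_def ip_diff_left unit[OF i] using ipJ[of ?J a x] blk by (simp add: subset_iff)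
      have "0 \<le> A" by (simp add: A_def)
      have "L2_set a ?J = 1 / A * A"
        using L2_set_scale[of "1 / A" ?b ?J] \<open>0 \<le> A\<close> by (simp add: a_def A_def)
      then have a1: "L2_set a ?J \<le> 1" by (simp split: if_splits)
      have "0 \<le> ip n c x" if x: "x \<in> cone_body n k" for x
      proof -
        have "(\<Sum>j\<in>?J. a j * x j) \<le> L2_set a ?J * L2_set x ?J" by (rule inner_le_L2_set)
        also have "\<dots> \<le> 1 * L2_set x ?J" using a1 by (intro mult_right_mono) auto
        also have "\<dots> \<le> x i" using x i by (simp add: cone_body_def)
        finally show ?thesis by (simp add: cx)
      qed
      then have "0 \<le> ip n c ?b" by (rule ge)
      then have "(\<Sum>j\<in>?J. a j * ?b j) \<le> ?b i" by (simp add: cx)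
      also have "(\<Sum>j\<in>?J. a j * ?b j) = 1 / A * (\<Sum>j\<in>?J. (?b j)\<^sup>2)"
        by (simp add: a_def sum_distrib_left power2_eq_square mult.assoc)
      also have "(\<Sum>j\<in>?J. (?b j)\<^sup>2) = A\<^sup>2" by (simp add: A_def L2_set_def sum_nonneg)
      finally show ?thesis by (simp add: A_def[symmetric] power2_eq_square split: if_splits)
    qed
    moreover have "(\<Sum>i<k. ?b i) \<le> 1"
    proof -
      have "ip n (\<lambda>j. if j \<in> {..<k} then -1 else 0) x = - (\<Sum>i<k. x i)" for x
        using ipJ[of "{..<k}" "\<lambda>_. -1" x] k by (simp add: sum_negf)
      moreover have "-1 \<le> ip n (\<lambda>j. if j \<in> {..<k} then -1 else 0) ?b"
        by (rule ge) (simp only: calculation, simp add: cone_body_def)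
      ultimately show ?thesis by (simp only:)
    qed
    ultimately show ?thesis using bR by (simp add: cone_body_def)
  qed
  show "0 < ?b i" if i: "i < k"
  proof -
    let ?c = "\<lambda>j. if j = i then 1 else 0 :: real"
    have "integrable (leb n) (\<lambda>x. indicator ?B x *\<^sub>R r)"
      using Bmeas Bfin by (intro integrableI_bounded_set_indicator[where B = "\<bar>r\<bar>"]) auto
    moreover have "indicator ?B x * r \<le> indicator ?K x * ip n ?c x" for x
    proof (cases "x \<in> ?B")
      case True
      then have "l i \<le> x i" using i k by (auto simp: PiE_iff)
      with True sub i show ?thesis unfolding unit[OF i] by (auto simp: l_def)
    next
      case False
      have "0 \<le> ip n ?c x" if "x \<in> ?K"
        unfolding unit[OF i] using that i k cone_body_nonneg by auto
      with False show ?thesis by (auto simp: indicator_def)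
    qed
    ultimately have "(\<integral>x. indicator ?B x * r \<partial>leb n) \<le> (\<integral>x. indicator ?K x * ip n ?c x \<partial>leb n)"
      using ip_barycenter(1)[OF meas fin bd vol, of ?c] by (intro integral_mono) auto
    also have "\<dots> = ip n ?c ?b * vol n (cone_body n k)"
      using ip_barycenter(2)[OF meas fin bd vol, of ?c] by simp
    also have "ip n ?c ?b = ?b i" by (rule unit[OF i])
    also have "(\<integral>x. indicator ?B x * r \<partial>leb n) = r * measure (leb n) ?B"
      using Bmeas Bfin by simp
    finally have "0 < ?b i * vol n (cone_body n k)" using r Bpos by (meson less_le_trans mult_pos_pos)
    then show ?thesis using vol by (simp add: zero_less_mult_iff)
  qed
qed

section \<open>The lower bound on the number of facets\<close>

text \<open>Lowering height \<open>i\<close> slightly stays in the body, where heights are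
  nonnegative.\<close>

lemma interior_cone_body_pos:
  assumes k: "k \<le> n" and s: "s \<in> interior_n n (cone_body n k)" and i: "i < k"
  shows "0 < s i"
proof -
  obtain e where e: "0 < e" "\<And>y. y \<in> Rn n \<Longrightarrow> dist_n n s y < e \<Longrightarrow> y \<in> cone_body n k"
    using s by (auto simp: interior_n_def)
  define y where "y = s(i := s i - e / 2)"
  have "s \<in> Rn n" using s by (simp add: interior_n_def cone_body_def)
  then have "y \<in> Rn n" using i k by (auto simp: y_def Rn_def)
  moreover have "dist_n n s y < e"
  proof -
    have "(\<Sum>j<n. (s j - y j)\<^sup>2) = (\<Sum>j<n. if j = i then (e / 2)\<^sup>2 else 0)"
      by (intro sum.cong) (auto simp: y_def)
    also have "\<dots> = (e / 2)\<^sup>2" using i k by simp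
    finally show ?thesis using e by (simp add: dist_n_def)
  qed
  ultimately have "0 \<le> y i" using e(2) cone_body_nonneg i by blast
  then show ?thesis using e by (simp add: y_def)
qed

text \<open>The outer inclusion gives \<open>P\<close> an interior point and bounds the facet
  functionals on the body by \<open>t\<close> times their value on \<open>P\<close>. The escaping
  point then satisfies all facet inequalities, and the inner inclusion puts it back into the
  body.\<close>

lemma many_facets:
  assumes k: "4 \<le> k" "(m + 1) * k \<le> n"
    and \<xi>: "\<xi> \<in> cone_body n k" "\<And>i. i < k \<Longrightarrow> 0 < \<xi> i"
    and t: "0 < t" "t \<le> (real k - 1) / 3"
    and P: "polytope_n n P" "P \<subseteq> translate (cone_body n k) \<xi>" "translate (cone_body n k) \<xi> \<subseteq> dilate t P"
  shows "exp (real m / 64) \<le> real (card {F. facet_n n P F})"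
proof (rule ccontr)
  assume few: "\<not> ?thesis"
  have "1 * k \<le> (m + 1) * k" by (rule mult_right_mono) auto
  then have kn: "k \<le> n" using k by simp
  obtain S where S: "finite S" "S \<subseteq> Rn n" and PS: "P = hull_n S"
    using P(1) by (auto simp: polytope_n_def hull_n_def)
  have scaled: "(\<lambda>j. (x j - \<xi> j) / t) \<in> P" if x: "x \<in> cone_body n k" for x
  proof -
    have "vsub x \<xi> \<in> dilate t P" using x P(3) by (auto simp: translate_def)
    then obtain p where p: "p \<in> P" "vsub x \<xi> = vscale t p" by (auto simp: dilate_def)
    have "p j = (x j - \<xi> j) / t" for j
      using fun_cong[OF p(2), of j] t by (simp add: vsub_def vscale_def field_simps)
    then have "p = (\<lambda>j. (x j - \<xi> j) / t)" by blast
    with p show ?thesis by simp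
  qed
  \<comment> \<open>The images of the margin around \<open>cone_center k\<close>, and of that point,
    under \<open>x \<mapsto> (x - \<xi>) / t\<close>, which maps the body into
    \<open>P\<close>.\<close>
  define r where "r = 1 / (4 * real k) / t"
  define c where "c = (\<lambda>j. (cone_center k j - \<xi> j) / t)"
  have r: "0 < r" using k t by (simp add: r_def)
  have "(\<lambda>j. c j + (if j = i then s else 0)) \<in> hull_n S" if i: "i < n" and s: "\<bar>s\<bar> = r" for i s
  proof -
    define y where "y = (\<lambda>j. cone_center k j + (if j = i then t * s else 0))"
    have ts: "\<bar>t * s\<bar> = 1 / (4 * real k)" using t s by (simp add: abs_mult r_def)
    have "y \<in> cone_body n k"
    proof (rule cone_center_nbhd)
      show "y \<in> Rn n" using i kn by (auto simp: y_def Rn_def cone_center_def)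
      fix l assume l: "l < k"
      show "\<bar>y l - 1 / (2 * real k)\<bar> \<le> 1 / (4 * real k)"
        using l ts by (simp add: y_def cone_center_def)
      have "L2_set y (block n k l) \<le> (\<Sum>j\<in>block n k l. \<bar>y j\<bar>)" by (rule L2_set_le_sum_abs)
      also have "\<dots> = (\<Sum>j\<in>block n k l. if j = i then \<bar>t * s\<bar> else 0)"
        by (intro sum.cong) (auto simp: y_def cone_center_def block_def)
      also have "\<dots> \<le> \<bar>t * s\<bar>" by simp
      finally show "L2_set y (block n k l) \<le> 1 / (4 * real k)" using ts by simp
    qed (use k kn in auto)
    then have "(\<lambda>j. (y j - \<xi> j) / t) \<in> hull_n S" using scaled PS by simp
    moreover have "(\<lambda>j. (y j - \<xi> j) / t) = (\<lambda>j. c j + (if j = i then s else 0))"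
      using t by (auto simp: y_def c_def field_simps)
    ultimately show ?thesis by simp
  qed
  moreover have "c \<in> Rn n" using \<xi> kn by (auto simp: c_def Rn_def cone_center_def cone_body_def)
  ultimately obtain E where E: "finite E" "card E \<le> card {F. facet_n n P F}"
    "\<forall>a\<in>E. \<forall>x\<in>P. ip n a x \<le> 1 + ip n a c"
    "\<forall>x\<in>Rn n. (\<forall>a\<in>E. ip n a x \<le> 1 + ip n a c) \<longrightarrow> x \<in> P"
    using facet_representation[OF S, of c r] r k kn unfolding PS by auto
  have "\<exists>x\<in>Rn n. x \<notin> cone_body n k \<and> (\<forall>a\<in>E. ip n a (\<lambda>j. x j - \<xi> j) \<le> 1 + ip n a c)"
  proof (rule cone_body_escape[OF k(1) kn \<xi> _ E(1) _ t])
    show "m \<le> card (block n k i)" if "i < k" for i using card_block[OF that k(2)] .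
    show "real (card E) < exp (real m / 64)" using E(2) few by linarith
    fix a x assume a: "a \<in> E" and x: "x \<in> cone_body n k"
    have "ip n a (\<lambda>j. 1 / t * (x j - \<xi> j)) \<le> 1 + ip n a c" using E(3) a scaled[OF x] by simp
    then show "ip n a (\<lambda>j. x j - \<xi> j) \<le> t * (1 + ip n a c)"
      unfolding ip_scale_right using t by (simp add: field_simps)
  qed
  then obtain x where x: "x \<in> Rn n" "x \<notin> cone_body n k"
    "\<forall>a\<in>E. ip n a (\<lambda>j. x j - \<xi> j) \<le> 1 + ip n a c" by blast
  have "(\<lambda>j. x j - \<xi> j) \<in> Rn n" using x \<xi>(1) by (auto simp: Rn_def cone_body_def)
  then have "(\<lambda>j. x j - \<xi> j) \<in> translate (cone_body n k) \<xi>" using E(4) x(3) P(2) by blast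
  then obtain y where "y \<in> cone_body n k" "(\<lambda>j. x j - \<xi> j) = vsub y \<xi>" by (auto simp: translate_def)
  then have "y = x" by (auto simp: vsub_def fun_eq_iff)
  with \<open>y \<in> _\<close> x(2) show False by simp
qed

text \<open>Here \<open>L\<close> is \<open>ln N\<close>. Blocks need \<open>m\<close> at least
  \<open>64 * L\<close> for \<open>exp (m / 64)\<close> to reach \<open>N\<close>, and
  \<open>k\<close> is the number of cones that fit. Since \<open>L \<ge> 1 / 2\<close>,
  \<open>m + 1 \<le> 68 * L\<close>, so \<open>k + 1\<close> exceeds \<open>n / (68 * L)\<close>;
  the constant 2000 absorbs the rounding.\<close>

lemma block_parameters:
  fixes L :: real
  assumes L: "1 / 2 \<le> L" "L \<le> real n / 2000"
  shows "\<exists>m k. 64 * L \<le> real m \<and> 4 \<le> k \<and> (m + 1) * k \<le> n \<and> real n / (2000 * L) \<le> (real k - 1) / 3"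
proof -
  define m where "m = nat \<lceil>64 * L\<rceil>"
  define k where "k = n div (m + 1)"
  define T where "T = real n / L"
  have m: "64 * L \<le> real m" "real m \<le> 64 * L + 1" using L by (auto simp: m_def)
  then have "real (m + 1) \<le> 68 * L" using L by simp
  have T: "2000 \<le> T" using L by (simp add: T_def field_simps)
  have "n = k * (m + 1) + n mod (m + 1)" by (simp only: k_def div_mult_mod_eq)
  moreover have "n mod (m + 1) < m + 1" by simp
  ultimately have "n < k * (m + 1) + (m + 1)" by linarith
  then have "n < (m + 1) * (k + 1)" by (simp add: algebra_simps)
  then have "real n < real (m + 1) * real (k + 1)" by (simp only: of_nat_less_iff flip: of_nat_mult)
  also have "\<dots> \<le> (68 * L) * real (k + 1)" using \<open>real (m + 1) \<le> 68 * L\<close> by (intro mult_right_mono) auto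
  finally have "T < 68 * real (k + 1)" using L by (simp add: T_def field_simps)
  then have "T / 2000 \<le> (real k - 1) / 3" "3 < real k" using T by simp_all
  moreover have "(m + 1) * k \<le> n" by (simp only: k_def times_div_less_eq_dividend)
  ultimately show ?thesis using m by (intro exI[of _ m] exI[of _ k]) (auto simp: T_def mult.commute)
qed

theorem theorem1p2:
  shows "\<exists>C>0. \<exists>n0::nat. \<forall>n\<ge>n0. \<forall>N::nat.
    C * real n ^ 2 \<le> real N \<and> real N \<le> exp (real n / C) \<longrightarrow>
    (\<exists>K. convex_body n K \<and>
       (\<forall>s. santalo_point n K s \<longrightarrow>
          (\<forall>\<xi>\<in>seg (barycenter n K) s. \<forall>P. polytope_n n P \<and> P \<subseteq> Rn n \<and>
              P \<subseteq> translate K \<xi> \<and> translate K \<xi> \<subseteq> dilate (real n / (C * ln (real N))) P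
              \<longrightarrow> real N \<le> real (card {F. facet_n n P F}))))"
proof (intro exI[of _ "2000 :: real"] exI[of _ "1 :: nat"] conjI allI impI)
  fix n N :: nat
  assume n: "1 \<le> n" and N: "2000 * (real n)\<^sup>2 \<le> real N \<and> real N \<le> exp (real n / 2000)"
  \<comment> \<open>The lower bound on \<open>N\<close> keeps \<open>ln N\<close> away from
    0.\<close>
  have "1 \<le> (real n)\<^sup>2" using n by simp
  then have N2: "2 \<le> real N" using N by linarith
  then have "ln 2 \<le> ln (real N)" by simp
  then have L: "1 / 2 \<le> ln (real N)" using ln2_ge_two_thirds by simp
  moreover have "ln (real N) \<le> ln (exp (real n / 2000))"
    using N N2 by (subst ln_le_cancel_iff) auto
  then have "ln (real N) \<le> real n / 2000" by simp
  ultimately obtain m k where mk: "64 * ln (real N) \<le> real m" "4 \<le> k" "(m + 1) * k \<le> n"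
    "real n / (2000 * ln (real N)) \<le> (real k - 1) / 3"
    using block_parameters by blast
  have "1 * k \<le> (m + 1) * k" by (rule mult_right_mono) auto
  then have k: "0 < k" "k \<le> n" using mk by simp_all
  let ?K = "cone_body n k"
  show "\<exists>K. convex_body n K \<and>
       (\<forall>s. santalo_point n K s \<longrightarrow>
          (\<forall>\<xi>\<in>seg (barycenter n K) s. \<forall>P. polytope_n n P \<and> P \<subseteq> Rn n \<and>
              P \<subseteq> translate K \<xi> \<and> translate K \<xi> \<subseteq> dilate (real n / (2000 * ln (real N))) P
              \<longrightarrow> real N \<le> real (card {F. facet_n n P F})))"
  proof (intro exI[of _ ?K] conjI allI impI ballI)
    show "convex_body n ?K" by (rule convex_body_cone_body[OF k])
    fix s \<xi> P
    assume "santalo_point n ?K s" and "\<xi> \<in> seg (barycenter n ?K) s"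
      and P: "polytope_n n P \<and> P \<subseteq> Rn n \<and> P \<subseteq> translate ?K \<xi> \<and>
        translate ?K \<xi> \<subseteq> dilate (real n / (2000 * ln (real N))) P"
    then obtain u where u: "0 \<le> u" "u \<le> 1"
      and \<xi>: "\<xi> = vadd (vscale (1 - u) (barycenter n ?K)) (vscale u s)"
      and s: "s \<in> interior_n n ?K"
      by (auto simp: seg_def santalo_point_def)
    have "\<xi> \<in> ?K"
    proof -
      have "s \<in> ?K" using s by (simp add: interior_n_def)
      then have "vadd (vscale u s) (vscale (1 - u) (barycenter n ?K)) \<in> ?K"
        using convex_cone_body barycenter_cone_body(1)[OF k] u unfolding convex_n_def by blast
      then show ?thesis by (simp add: \<xi> vadd_def add.commute)
    qed
    \<comment> \<open>At \<open>u = 0\<close> the barycenter supplies strict positivity; for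
      \<open>u > 0\<close> the Santalo point does, being interior, and the barycenter's share is
      nonnegative.\<close>
    moreover have "0 < \<xi> i" if i: "i < k" for i
    proof (cases "u = 0")
      case True
      then show ?thesis using barycenter_cone_body(2)[OF k i] by (simp add: \<xi> vadd_def vscale_def)
    next
      case False
      have "0 < u * s i" using False u interior_cone_body_pos[OF k(2) s i] by simp
      moreover have "0 \<le> (1 - u) * barycenter n ?K i"
        using u barycenter_cone_body(2)[OF k i] by simp
      ultimately show ?thesis by (simp add: \<xi> vadd_def vscale_def)
    qed
    moreover have "0 < real n / (2000 * ln (real N))" using n L by simp
    ultimately have "exp (real m / 64) \<le> real (card {F. facet_n n P F})"
      using many_facets[OF mk(2,3)] mk(4) P by blast
    moreover have "real N \<le> exp (real m / 64)"
    proof -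
      have "exp (ln (real N)) \<le> exp (real m / 64)" using mk(1) by simp
      then show ?thesis using N2 by simp
    qed
    ultimately show "real N \<le> real (card {F. facet_n n P F})" by linarith
  qed
qed simp

end
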